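(* Let $n\ge 1$, let $X=H_{\mathbb R}^n$ be real hyperbolic space with geodesic distance $d$, let $\mathfrak H$ be the space of half-spaces of $X$ with nonzero positive $G$-invariant measure $\mu_{\mathfrak H}$, where $G=O(1,n)$, and for $x\in X$ let $\Sigma_x\subset\mathfrak H$ be the set of half-spaces containing $x$. Then there is a constant $k>0$ such that for all $x,y\in X$, $$d(x,y)=k\,\mu_{\mathfrak H}(\Sigma_x\bigtriangleup\Sigma_y).$$ Hence $d$ is a kernel of negative type on $X$.
   Context: On $\mathbb R^{n+1}$ consider the form $\langle z,w\rangle=-z^0w^0+z^1w^1+\cdots+z^nw^n$. Real hyperbolic space $X=H_{\mathbb R}^n$ is the image in projective space $P_{\mathbb R}^n$ of the set of negative vectors $\{x\in\mathbb R^{n+1}:\langle x,x\rangle<0\}$; the same notation is used for a negative vector and its class. The geodesic distance is given by $\cosh d(x,y)=\frac{|\langle x,y\rangle|}{(\langle x,x\rangle\langle y,y\rangle)^{1/2}}$. The group $G=O(1,n)$ is the subgroup of $GL(n+1,\mathbb R)$ preserving $\langle\cdot,\cdot\rangle$; it acts isometrically and transitively on $X$. Half-spaces in $X$ are the $G$-translates of the half-space $H_0$ consisting of points with last coordinate positive, where a point of $X$ is represented by a negative vector with $x^0>0$. The space $\mathfrak H$ of half-spaces is identified with the topological homogeneous space $G/G(H_0)$, where $G(H_0)=\{g\in G: gH_0=H_0\}$. There is a nonzero positive $G$-invariant (Radon) measure $\mu_{\mathfrak H}$ on $\mathfrak H$, unique up to a positive multiple. $\bigtriangleup$ denotes symmetric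 difference. A semimetric $d$ on a set $X$ is a kernel of negative type if for every finite subset $\{x_1,\dots,x_m\}$ of $X$ and all real numbers $t_1,\dots,t_m$ with $\sum_{i=1}^m t_i=0$ one has $\sum_{i,j=1}^m t_it_j\,d(x_i,x_j)\le 0$. *)

theory Defs
  imports "HOL-Analysis.Analysis"
begin

text \<open>
  The coordinates \<open>0, \<dots>, n\<close> of \<open>\<real>\<^sup>n\<^sup>+\<^sup>1\<close> are the elements of a finite linearly
  ordered index type with \<open>n + 1\<close> elements; coordinate \<open>0\<close> is its least and
  coordinate \<open>n\<close> its greatest element.
\<close>

type_synonym 'n rvec = "(real, 'n) vec"
type_synonym 'n rmat = "((real, 'n) vec, 'n) vec"

definition idx_first :: "'n::{finite,linorder}" where
  "idx_first = Min UNIV"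

definition idx_last :: "'n::{finite,linorder}" where
  "idx_last = Max UNIV"

definition lorentz :: "'n::{finite,linorder} rvec \<Rightarrow> 'n rvec \<Rightarrow> real" where
  "lorentz z w = - (z $ idx_first * w $ idx_first) + (\<Sum>i\<in>UNIV - {idx_first}. z $ i * w $ i)"

text \<open>
  Points of projective space are lines through the origin, as sets of vectors; the class of a
  nonzero vector \<open>x\<close> is \<open>span {x}\<close>.
\<close>

definition hyp_space :: "('n::{finite,linorder} rvec) set set" where
  "hyp_space = {span {x} | x. lorentz x x < 0}"

definition hyp_dist :: "('n::{finite,linorder} rvec) set \<Rightarrow> ('n rvec) set \<Rightarrow> real" where
  "hyp_dist p q = (THE d. 0 \<le> d \<and>
     (\<forall>x\<in>p - {0}. \<forall>y\<in>q - {0}. cosh d = \<bar>lorentz x y\<bar> / sqrt (lorentz x x * lorentz y y)))"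

definition O1n :: "('n::{finite,linorder} rmat) set" where
  "O1n = {A. invertible A \<and> (\<forall>z w. lorentz (A *v z) (A *v w) = lorentz z w)}"

definition pt_act :: "'n::{finite,linorder} rmat \<Rightarrow> ('n rvec) set \<Rightarrow> ('n rvec) set" where
  "pt_act g p = (\<lambda>x. g *v x) ` p"

definition set_act :: "'n::{finite,linorder} rmat \<Rightarrow> ('n rvec) set set \<Rightarrow> ('n rvec) set set" where
  "set_act g H = pt_act g ` H"

definition base_half_space :: "('n::{finite,linorder} rvec) set set" where
  "base_half_space = {span {x} | x. lorentz x x < 0 \<and> 0 < x $ idx_first \<and> 0 < x $ idx_last}"

definition half_spaces :: "('n::{finite,linorder} rvec) set set set" where
  "half_spaces = {set_act g base_half_space | g. g \<in> O1n}"

text \<open>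
  The fibres of \<open>g \<mapsto> gH\<^sub>0\<close> on \<open>G\<close> are the left cosets of the stabilizer \<open>G(H\<^sub>0)\<close>, so the
  quotient topology of \<open>G/G(H\<^sub>0)\<close>, carried over to the set of half-spaces, is the final
  topology of this map.
\<close>

definition half_space_topology :: "('n::{finite,linorder} rvec) set set topology" where
  "half_space_topology = topology (\<lambda>U. U \<subseteq> half_spaces \<and>
     openin (top_of_set O1n) {g \<in> O1n. set_act g base_half_space \<in> U})"

definition radon_measure :: "'a topology \<Rightarrow> 'a measure \<Rightarrow> bool" where
  "radon_measure T M \<longleftrightarrow>
     space M = topspace T \<and>
     sets M = sigma_sets (topspace T) {U. openin T U} \<and>
     (\<forall>K. compactin T K \<longrightarrow> emeasure M K < \<infinity>) \<and>
     (\<forall>A\<in>sets M. emeasure M A = (INF U\<in>{U. openin T U \<and> A \<subseteq> U}. emeasure M U)) \<and>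
     (\<forall>U. openin T U \<longrightarrow> emeasure M U = (SUP K\<in>{K. compactin T K \<and> K \<subseteq> U}. emeasure M K))"

definition invariant_half_space_measure :: "('n::{finite,linorder} rvec) set set measure \<Rightarrow> bool" where
  "invariant_half_space_measure M \<longleftrightarrow>
     radon_measure half_space_topology M \<and>
     emeasure M (space M) \<noteq> 0 \<and>
     (\<forall>g\<in>O1n. \<forall>A\<in>sets M. emeasure M (set_act g ` A) = emeasure M A)"

definition half_spaces_at :: "('n::{finite,linorder} rvec) set \<Rightarrow> ('n rvec) set set set" where
  "half_spaces_at x = {H \<in> half_spaces. x \<in> H}"

definition semimetric_on :: "'a set \<Rightarrow> ('a \<Rightarrow> 'a \<Rightarrow> real) \<Rightarrow> bool" where
  "semimetric_on X d \<longleftrightarrow>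
     (\<forall>x\<in>X. \<forall>y\<in>X. 0 \<le> d x y) \<and>
     (\<forall>x\<in>X. d x x = 0) \<and>
     (\<forall>x\<in>X. \<forall>y\<in>X. d x y = d y x) \<and>
     (\<forall>x\<in>X. \<forall>y\<in>X. \<forall>z\<in>X. d x z \<le> d x y + d y z)"

definition kernel_of_negative_type :: "'a set \<Rightarrow> ('a \<Rightarrow> 'a \<Rightarrow> real) \<Rightarrow> bool" where
  "kernel_of_negative_type X d \<longleftrightarrow>
     semimetric_on X d \<and>
     (\<forall>F t. finite F \<and> F \<subseteq> X \<and> sum t F = 0 \<longrightarrow> (\<Sum>x\<in>F. \<Sum>y\<in>F. t x * t y * d x y) \<le> 0)"

lemma istopology_half_space:
  "istopology (\<lambda>U. U \<subseteq> half_spaces \<and>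
     openin (top_of_set O1n) {g \<in> O1n. set_act g base_half_space \<in> U})"
proof -
  have *: "{g \<in> O1n. set_act g base_half_space \<in> S \<inter> T} =
      {g \<in> O1n. set_act g base_half_space \<in> S} \<inter> {g \<in> O1n. set_act g base_half_space \<in> T}" for S T
    by blast
  have **: "{g \<in> O1n. set_act g base_half_space \<in> \<Union>K} =
      \<Union>((\<lambda>U. {g \<in> O1n. set_act g base_half_space \<in> U}) ` K)" for K
    by blast
  show ?thesis
    unfolding istopology_def * **
    by (intro conjI allI impI openin_Int openin_Union) auto
qed

lemma openin_half_space_topology:
  "openin half_space_topology U \<longleftrightarrow> U \<subseteq> half_spaces \<and>
     openin (top_of_set O1n) {g \<in> O1n. set_act g base_half_space \<in> U}"
  unfolding half_space_topology_def by (simp add: topology_inverse' istopology_half_space)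

lemma topspace_half_space_topology:
  "topspace half_space_topology = (half_spaces :: 'n::{finite,linorder} rvec set set set)"
proof -
  have "{g \<in> O1n. set_act g base_half_space \<in> half_spaces} = (O1n :: 'n rmat set)"
    by (auto simp: half_spaces_def)
  then have "openin half_space_topology (half_spaces :: 'n rvec set set set)"
    by (simp add: openin_half_space_topology)
  then show ?thesis
    unfolding topspace_def by (auto simp: openin_half_space_topology)
qed

lemma quotient_map_half_spaces:
  "quotient_map (top_of_set O1n) half_space_topology (\<lambda>g. set_act g base_half_space)"
  unfolding quotient_map_def topspace_half_space_topology openin_half_space_topology
  by (auto simp: half_spaces_def)

text \<open>Reverse Cauchy-Schwarz inequality; it makes the distance well defined.\<close>

lemma lorentz_reverse_Cauchy_Schwarz:
  fixes x y :: "'n::{finite,linorder} rvec"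
  assumes "lorentz x x < 0" "lorentz y y < 0"
  shows "lorentz x x * lorentz y y \<le> (lorentz x y)\<^sup>2"
proof -
  define I where "I = (UNIV :: 'n set) - {idx_first}"
  define a b where "a = x $ idx_first" and "b = y $ idx_first"
  define P Q R where "P = (\<Sum>i\<in>I. (x $ i)\<^sup>2)" and "Q = (\<Sum>i\<in>I. (y $ i)\<^sup>2)"
    and "R = (\<Sum>i\<in>I. x $ i * y $ i)"
  have xx: "lorentz x x = P - a\<^sup>2" and yy: "lorentz y y = Q - b\<^sup>2" and xy: "lorentz x y = R - a * b"
    by (simp_all add: lorentz_def P_def Q_def R_def a_def b_def I_def power2_eq_square)
  have P: "0 \<le> P" "P < a\<^sup>2" and Q: "0 \<le> Q" "Q < b\<^sup>2"
    using assms by (auto simp: xx yy P_def Q_def intro: sum_nonneg)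
  have CS: "R\<^sup>2 \<le> P * Q"
    unfolding P_def Q_def R_def by (rule Cauchy_Schwarz_ineq_sum)
  define p q where "p = sqrt P" and "q = sqrt Q"
  have p: "0 \<le> p" "p\<^sup>2 = P" "p \<le> \<bar>a\<bar>" and q: "0 \<le> q" "q\<^sup>2 = Q" "q \<le> \<bar>b\<bar>"
    using P Q by (simp_all add: p_def q_def real_le_lsqrt less_imp_le)
  have R: "\<bar>R\<bar> \<le> p * q"
    using CS p q abs_le_square_iff[of R "p * q"] by (simp add: power_mult_distrib)
  have pq: "p * q \<le> \<bar>a\<bar> * \<bar>b\<bar>"
    using p q by (intro mult_mono) auto
  have "\<bar>a\<bar> * \<bar>b\<bar> - p * q \<le> \<bar>R - a * b\<bar>"
    using R abs_triangle_ineq2_sym[of R "a * b"] by (simp add: abs_mult)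
  then have "(\<bar>a\<bar> * \<bar>b\<bar> - p * q)\<^sup>2 \<le> (R - a * b)\<^sup>2"
    using pq by (simp add: abs_le_square_iff[symmetric])
  moreover have "(P - a\<^sup>2) * (Q - b\<^sup>2) = (\<bar>a\<bar> * \<bar>b\<bar> - p * q)\<^sup>2 - (\<bar>a\<bar> * q - \<bar>b\<bar> * p)\<^sup>2"
    by (simp add: p(2)[symmetric] q(2)[symmetric] power2_eq_square algebra_simps)
  ultimately show ?thesis
    unfolding xx yy xy using zero_le_power2[of "\<bar>a\<bar> * q - \<bar>b\<bar> * p"] by linarith
qed

lemma lorentz_scaleR: "lorentz (c *\<^sub>R x) (e *\<^sub>R y) = c * e * lorentz x y"
  by (simp add: lorentz_def sum_distrib_left algebra_simps)

lemma hyp_dist_span: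
  fixes x y :: "'n::{finite,linorder} rvec"
  assumes x: "lorentz x x < 0" and y: "lorentz y y < 0"
  shows "0 \<le> hyp_dist (span {x}) (span {y})"
    and "cosh (hyp_dist (span {x}) (span {y})) = \<bar>lorentz x y\<bar> / sqrt (lorentz x x * lorentz y y)"
proof -
  define v where "v = \<bar>lorentz x y\<bar> / sqrt (lorentz x x * lorentz y y)"
  have pos: "0 < lorentz x x * lorentz y y"
    using x y by (simp add: mult_neg_neg)
  have "sqrt (lorentz x x * lorentz y y) \<le> \<bar>lorentz x y\<bar>"
    using lorentz_reverse_Cauchy_Schwarz[OF x y] by (intro real_le_lsqrt) auto
  then have v: "1 \<le> v"
    using pos by (simp add: v_def)
  have x0: "x \<noteq> 0" and y0: "y \<noteq> 0"
    using x y by (auto simp: lorentz_def)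
  have rep: "\<bar>lorentz u w\<bar> / sqrt (lorentz u u * lorentz w w) = v"
    if uw: "u \<in> span {x} - {0}" "w \<in> span {y} - {0}" for u w
  proof -
    obtain c e where ce: "u = c *\<^sub>R x" "w = e *\<^sub>R y" "c \<noteq> 0" "e \<noteq> 0"
      using uw by (auto simp: span_singleton)
    have "lorentz u u * lorentz w w = (c * e)\<^sup>2 * (lorentz x x * lorentz y y)"
      by (simp add: ce lorentz_scaleR power2_eq_square)
    then have "sqrt (lorentz u u * lorentz w w) = \<bar>c * e\<bar> * sqrt (lorentz x x * lorentz y y)"
      by (simp add: real_sqrt_mult)
    then show ?thesis
      using ce by (simp add: lorentz_scaleR abs_mult v_def)
  qed
  have mem: "x \<in> span {x} - {0}" "y \<in> span {y} - {0}"
    using x0 y0 by (auto intro: span_base)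
  have "hyp_dist (span {x}) (span {y}) = arcosh v"
    unfolding hyp_dist_def
  proof (rule the_equality, intro conjI ballI)
    show "0 \<le> arcosh v" using v by simp
  next
    fix u w assume "u \<in> span {x} - {0}" "w \<in> span {y} - {0}"
    then show "cosh (arcosh v) = \<bar>lorentz u w\<bar> / sqrt (lorentz u u * lorentz w w)"
      using rep v by simp
  next
    fix d :: real
    assume d: "0 \<le> d \<and> (\<forall>u\<in>span {x} - {0}. \<forall>w\<in>span {y} - {0}.
        cosh d = \<bar>lorentz u w\<bar> / sqrt (lorentz u u * lorentz w w))"
    then have "cosh d = v" using mem rep by metis
    then show "d = arcosh v" using d arcosh_cosh_real by metis
  qed
  then show "0 \<le> hyp_dist (span {x}) (span {y})"
    and "cosh (hyp_dist (span {x}) (span {y})) = \<bar>lorentz x y\<bar> / sqrt (lorentz x x * lorentz y y)"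
    using v by (simp_all add: v_def)
qed

end

theory Submission
  imports Defs
begin

text \<open>
  The number \<open>F x y\<close> that a measure assigns to the half-spaces separating \<open>x\<close> from \<open>y\<close> is a Crofton
  formula for the distance. If the measure is invariant, \<open>F\<close> is invariant under isometries, hence a
  function \<open>\<phi>\<close> of the distance, since any pair of points can be moved to two points of one fixed
  geodesic. Half-spaces and their complements are convex, so for \<open>y\<close> on the segment from \<open>x\<close> to \<open>z\<close> a
  half-space separates \<open>x\<close> from \<open>z\<close> iff it separates one of the pairs \<open>x, y\<close> and \<open>y, z\<close>, and
  it never separates both; thus \<open>F x z = F x y + F y z\<close> and \<open>\<phi>\<close> is additive. A finite nonnegative additive function
  is linear, so \<open>F\<close> is a multiple of the distance (\<open>geodesically_additive_eq_distance\<close>). The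
  multiple is positive because there are countably many pairs of points such that every half-space
  separates one of them (\<open>countable_separating_set\<close>).

  The argument is applied to two measures. For an arbitrary invariant Radon measure on the space of
  half-spaces, finiteness is the point that needs topology: the half-spaces separating two points
  have unit normals of bounded Euclidean length (\<open>separates_bounded\<close>), and half-spaces with bounded
  normals form a closed compact set (\<open>bounded_normal_half_spaces\<close>).

  That the distance is of negative type is a statement without reference to a measure. For this
  part the second measure is an explicit one: Lebesgue measure on the set of vectors \<open>v\<close> with
  \<open>0 < \<langle>v,v\<rangle> < 1\<close>, each regarded as the normal of a half-space. It is invariant under reflections
  (\<open>emeasure_lborel_linear_involution\<close>), and reflections already act transitively on pairs of
  points at a given distance. Once the distance is a multiple of the measure of a symmetric
  difference, it is the squared \<open>L\<^sup>2\<close> distance of indicator functions, and such kernels are of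
  negative type (\<open>kernel_of_negative_type_measure\<close>).
\<close>

section \<open>The Lorentz form and timelike vectors\<close>

lemma lorentz_eq_inner: "lorentz z w = z \<bullet> w - 2 * z $ idx_first * w $ idx_first"
proof -
  have "z \<bullet> w = z $ idx_first * w $ idx_first + (\<Sum>i\<in>UNIV - {idx_first}. z $ i * w $ i)"
    by (simp add: inner_vec_def sum.remove)
  then show ?thesis
    by (simp add: lorentz_def)
qed

lemma lorentz_commute: "lorentz x y = lorentz y x"
  by (simp add: lorentz_eq_inner inner_commute)

lemma lorentz_linear [simp]:
  "lorentz (x + y) z = lorentz x z + lorentz y z"
  "lorentz z (x + y) = lorentz z x + lorentz z y"
  "lorentz (x - y) z = lorentz x z - lorentz y z"
  "lorentz z (x - y) = lorentz z x - lorentz z y"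
  "lorentz (a *\<^sub>R x) z = a * lorentz x z"
  "lorentz z (a *\<^sub>R x) = a * lorentz z x"
  "lorentz (- x) z = - lorentz x z"
  "lorentz z (- x) = - lorentz z x"
  "lorentz 0 z = 0"
  "lorentz z 0 = 0"
  by (simp_all add: lorentz_eq_inner inner_diff_left inner_diff_right inner_add_left
      inner_add_right algebra_simps)

lemma continuous_on_lorentz [continuous_intros]:
  assumes "continuous_on S f" "continuous_on S g"
  shows "continuous_on S (\<lambda>x. lorentz (f x) (g x))"
  unfolding lorentz_eq_inner by (intro continuous_intros assms)

abbreviation e_first :: "'n::{finite,linorder} rvec" where
  "e_first \<equiv> axis idx_first 1"

abbreviation e_last :: "'n::{finite,linorder} rvec" where
  "e_last \<equiv> axis idx_last 1"

text \<open>
  With \<open>x = x\<^sup>0 e\<^sub>0 + spatial x\<close> the form is a Euclidean inner product of spatial parts minus the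
  product of the time coordinates, so that facts about timelike vectors become instances of the
  Cauchy-Schwarz inequality.
\<close>

definition spatial :: "'n::{finite,linorder} rvec \<Rightarrow> 'n rvec" where
  "spatial x = x - (x $ idx_first) *\<^sub>R e_first"

lemma spatial_first [simp]: "spatial x $ idx_first = 0"
  by (simp add: spatial_def)

lemma lorentz_eq_spatial: "lorentz x y = spatial x \<bullet> spatial y - x $ idx_first * y $ idx_first"
  by (simp add: lorentz_eq_inner spatial_def inner_diff_left inner_diff_right inner_axis
      inner_axis' algebra_simps)

lemma lorentz_e_first [simp]: "lorentz x e_first = - x $ idx_first" "lorentz e_first x = - x $ idx_first"
  by (simp_all add: lorentz_eq_inner inner_axis inner_axis')

lemma lorentz_self: "lorentz x x = (norm (spatial x))\<^sup>2 - (x $ idx_first)\<^sup>2"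
  by (simp add: lorentz_eq_spatial dot_square_norm power2_eq_square[of "x $ _"])

lemma norm_eq_spatial: "(norm x)\<^sup>2 = (norm (spatial x))\<^sup>2 + (x $ idx_first)\<^sup>2"
  using lorentz_eq_inner[of x x]
  by (simp add: lorentz_self dot_square_norm power2_eq_square[of "x $ _"])

lemma idx_first_neq_last:
  assumes "2 \<le> CARD('n::{finite,linorder})"
  shows "idx_last \<noteq> (idx_first :: 'n)"
proof
  assume eq: "idx_last = (idx_first :: 'n)"
  have "i = idx_first" for i :: 'n
    using eq Min_le[of UNIV i] Max_ge[of UNIV i] unfolding idx_first_def idx_last_def
    by (metis UNIV_I antisym finite_code)
  then have "(UNIV :: 'n set) = {idx_first}" by auto
  then have "CARD('n) = 1" by (metis card.empty card.insert empty_iff finite.emptyI One_nat_def)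
  with assms show False by simp
qed

text \<open>
  One sheet of the hyperboloid. Every point of hyperbolic space is spanned by exactly one
  vector of this sheet, which serves as its representative throughout.
\<close>

definition future :: "('n::{finite,linorder} rvec) set" where
  "future = {x. lorentz x x = -1 \<and> 0 < x $ idx_first}"

lemma e_first_future [simp]: "e_first \<in> future"
  by (simp add: future_def)

text \<open>
  For timelike vectors the product of the time coordinates outweighs the spatial inner product, so
  the sign of the form shows whether two of them lie in the same half of the light cone.
\<close>

lemma lorentz_timelike_neg:
  assumes "x \<in> future" and w: "lorentz w w < 0"
  shows "lorentz x w < 0 \<longleftrightarrow> 0 < w $ idx_first"
proof -
  have x: "norm (spatial x) < x $ idx_first" "0 < x $ idx_first"
    using assms(1) by (auto simp: future_def lorentz_self intro: power2_less_imp_less)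
  have "norm (spatial w) < \<bar>w $ idx_first\<bar>"
    using w by (auto simp: lorentz_self intro: power2_less_imp_less)
  moreover have "norm (spatial x) * norm (spatial w) \<le> x $ idx_first * norm (spatial w)"
    using x by (intro mult_right_mono) auto
  ultimately have "norm (spatial x) * norm (spatial w) < x $ idx_first * \<bar>w $ idx_first\<bar>"
    using x by (smt (verit) mult_strict_left_mono)
  then have "\<bar>spatial x \<bullet> spatial w\<bar> < x $ idx_first * \<bar>w $ idx_first\<bar>"
    using Cauchy_Schwarz_ineq2[of "spatial x" "spatial w"] by linarith
  then show ?thesis
    using x by (smt (verit) lorentz_eq_spatial mult_minus_right mult_nonneg_nonneg)
qed

lemma future_lorentz_le:
  assumes "x \<in> future" "y \<in> future"
  shows "lorentz x y \<le> -1"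
proof -
  have "lorentz x y < 0"
    using assms lorentz_timelike_neg[of x y] by (simp add: future_def)
  moreover have "1\<^sup>2 \<le> (lorentz x y)\<^sup>2"
    using lorentz_reverse_Cauchy_Schwarz[of x y] assms by (simp add: future_def)
  ultimately show ?thesis
    by (smt (verit) power2_minus power_mono_iff power2_le_imp_le)
qed

lemma hyp_dist_future:
  assumes "x \<in> future" "y \<in> future"
  shows "hyp_dist (span {x}) (span {y}) = arcosh (- lorentz x y)"
proof -
  have n: "lorentz x x = -1" "lorentz y y = -1" using assms by (auto simp: future_def)
  have "cosh (hyp_dist (span {x}) (span {y})) = - lorentz x y"
    using hyp_dist_span(2)[of x y] future_lorentz_le[OF assms] n by simp
  then show ?thesis
    using hyp_dist_span(1)[of x y] n arcosh_cosh_real by fastforce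
qed

lemma span_scale_eq: "c \<noteq> (0::real) \<Longrightarrow> span {c *\<^sub>R x} = span {x}"
  using span_image_scale[of "{x}" "\<lambda>_. c"] by simp

lemma normalize_timelike:
  assumes "lorentz x x < 0" "0 < x $ idx_first"
  shows "(1 / sqrt (- lorentz x x)) *\<^sub>R x \<in> future"
proof -
  have "1 / sqrt (- lorentz x x) * (1 / sqrt (- lorentz x x)) = 1 / - lorentz x x"
    using assms by (simp add: field_simps)
  then show ?thesis
    using assms by (simp add: future_def flip: mult.assoc)
qed

lemma hyp_space_eq: "(hyp_space :: ('n::{finite,linorder} rvec) set set) = (\<lambda>x. span {x}) ` future"
proof
  show "(\<lambda>x. span {x}) ` future \<subseteq> (hyp_space :: 'n rvec set set)"
    by (auto simp: hyp_space_def future_def)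
  show "(hyp_space :: 'n rvec set set) \<subseteq> (\<lambda>x. span {x}) ` future"
  proof
    fix p :: "'n rvec set" assume "p \<in> hyp_space"
    then obtain x where x: "p = span {x}" "lorentz x x < 0"
      by (auto simp: hyp_space_def)
    then have "x $ idx_first \<noteq> 0" by (auto simp: lorentz_self)
    then obtain y where y: "p = span {y}" "lorentz y y < 0" "0 < y $ idx_first"
      using x span_scale_eq[of "-1" x]
      by (cases "0 < x $ idx_first") (auto intro: that[of x] that[of "-x"])
    have "p = span {(1 / sqrt (- lorentz y y)) *\<^sub>R y}"
      using y by (subst span_scale_eq) auto
    then show "p \<in> (\<lambda>x. span {x}) ` future"
      using normalize_timelike[of y] y by blast
  qed
qed

section \<open>Reflections and the standard geodesic\<close>

text \<open>
  The reflection in the hyperplane orthogonal to \<open>u\<close>. Reflections in spacelike vectors generate all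
  isometries that the argument has to construct: they preserve \<open>future\<close>, they are involutions, and two of
  them suffice to bring a pair of points into standard position.
\<close>

definition reflect :: "'n::{finite,linorder} rvec \<Rightarrow> 'n rvec \<Rightarrow> 'n rvec" where
  "reflect u x = x - (2 * lorentz x u / lorentz u u) *\<^sub>R u"

lemma lorentz_reflect:
  assumes "lorentz u u \<noteq> 0"
  shows "lorentz (reflect u x) y = lorentz x (reflect u y)"
  using assms by (simp add: reflect_def lorentz_commute[of u y])

lemma reflect_reflect [simp]:
  assumes "lorentz u u \<noteq> 0"
  shows "reflect u (reflect u x) = x"
proof -
  have "lorentz (reflect u x) u = - lorentz x u"
    using assms by (simp add: reflect_def)
  then show ?thesis
    by (simp add: reflect_def[of u "reflect u x"]) (simp add: reflect_def)
qed

lemma lorentz_reflect_reflect [simp]: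
  "lorentz u u \<noteq> 0 \<Longrightarrow> lorentz (reflect u x) (reflect u y) = lorentz x y"
  by (simp add: lorentz_reflect)

lemma linear_reflect: "linear (reflect u)"
  by (intro linearI) (simp_all add: reflect_def algebra_simps add_divide_distrib)

text \<open>
  Reflection in the perpendicular bisector of \<open>a\<close> and \<open>b\<close>; this produces all isometries below.
\<close>

lemma reflect_swap:
  assumes "lorentz a a = lorentz b b" "lorentz (a - b) (a - b) \<noteq> 0"
  shows "reflect (a - b) a = b"
proof -
  have "2 * lorentz a (a - b) = lorentz (a - b) (a - b)"
    using assms(1) by (simp add: lorentz_commute[of b a])
  then show ?thesis using assms(2) by (simp add: reflect_def)
qed

text \<open>
  Since \<open>\<langle>x, s x\<rangle> = -1 - 2\<langle>x,u\<rangle>\<^sup>2/\<langle>u,u\<rangle>\<close> is negative when \<open>u\<close> is spacelike, \<open>x\<close> and its mirror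
  image \<open>s x\<close> lie in the same half of the light cone.
\<close>

lemma reflect_future:
  assumes u: "0 < lorentz u u" and x: "x \<in> future"
  shows "reflect u x \<in> future"
proof -
  have "lorentz x (reflect u x) = - 1 - 2 * (lorentz x u)\<^sup>2 / lorentz u u"
    using x by (simp add: reflect_def future_def power2_eq_square)
  also have "\<dots> < 0" using u by (smt (verit) divide_nonneg_pos zero_le_power2)
  finally have "lorentz x (reflect u x) < 0" .
  moreover have "lorentz (reflect u x) (reflect u x) = -1"
    using u x by (simp add: future_def)
  ultimately show ?thesis
    using lorentz_timelike_neg[OF x, of "reflect u x"] by (simp add: future_def)
qed

text \<open>
  The unit speed geodesic that starts at \<open>e\<^sub>0\<close> in the direction of \<open>e\<^sub>n\<close>.
\<close>

definition ray :: "real \<Rightarrow> 'n::{finite,linorder} rvec" where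
  "ray t = cosh t *\<^sub>R e_first + sinh t *\<^sub>R e_last"

lemma ray_0 [simp]: "ray 0 = e_first"
  by (simp add: ray_def)

context
  assumes card: "2 \<le> CARD('n::{finite,linorder})"
begin

lemma first_neq_last [simp]: "idx_last \<noteq> (idx_first :: 'n)" "idx_first \<noteq> (idx_last :: 'n)"
  using idx_first_neq_last[OF card] by auto

lemma axis_first_last [simp]: "(e_last :: 'n rvec) $ idx_first = 0" "(e_first :: 'n rvec) $ idx_last = 0"
  "(e_last :: 'n rvec) $ idx_last = 1" "(e_first :: 'n rvec) $ idx_first = 1"
  by (simp_all add: axis_def)

lemma lorentz_e_last [simp]:
  "lorentz (x :: 'n rvec) e_last = x $ idx_last" "lorentz e_last (x :: 'n rvec) = x $ idx_last"
  by (simp_all add: lorentz_eq_inner inner_axis inner_axis')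

lemma lorentz_ray: "lorentz (ray s) (ray t :: 'n rvec) = - cosh (t - s)"
  by (simp add: ray_def cosh_diff)

lemma ray_future: "(ray t :: 'n rvec) \<in> future"
  using lorentz_ray[of t t] by (simp add: future_def ray_def)

text \<open>
  Points of a geodesic segment are nonnegative combinations of its end points, which is the form in
  which betweenness is used below.
\<close>

lemma ray_between:
  assumes "0 \<le> s" "s \<le> t" "0 < t"
  shows "(ray s :: 'n rvec) = (sinh (t - s) / sinh t) *\<^sub>R ray 0 + (sinh s / sinh t) *\<^sub>R ray t"
proof -
  define a b where "a = sinh (t - s) / sinh t" and "b = sinh s / sinh t"
  have t: "sinh t \<noteq> 0" using assms(3) by simp
  have "a + b * cosh t = (sinh (t - s) + sinh s * cosh t) / sinh t"
    by (simp add: a_def b_def add_divide_distrib)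
  also have "sinh (t - s) + sinh s * cosh t = cosh s * sinh t"
    by (simp add: sinh_diff)
  finally have 1: "a + b * cosh t = cosh s" using t by simp
  have 2: "b * sinh t = sinh s" using t by (simp add: b_def)
  have "a *\<^sub>R ray 0 + b *\<^sub>R ray t = (a + b * cosh t) *\<^sub>R e_first + (b * sinh t) *\<^sub>R (e_last :: 'n rvec)"
    by (simp add: ray_def scaleR_add_left scaleR_add_right)
  also have "\<dots> = ray s" by (simp only: 1 2 ray_def)
  finally show ?thesis unfolding a_def b_def by (rule sym)
qed

end

section \<open>Geodesically additive functions of two points\<close>

text \<open>
  Nonnegativity and additivity make \<open>f\<close> monotone. Comparing \<open>f (m t)\<close> with the values of \<open>f\<close> at the
  integers next to \<open>m t\<close> gives \<open>m \<bar>f t - f 1 \<cdot> t\<bar> \<le> f 1\<close> for all \<open>m\<close>.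
\<close>

lemma additive_nonneg_linear:
  fixes f :: "real \<Rightarrow> real"
  assumes add: "\<And>s t. 0 \<le> s \<Longrightarrow> 0 \<le> t \<Longrightarrow> f (s + t) = f s + f t"
    and nonneg: "\<And>t. 0 \<le> t \<Longrightarrow> 0 \<le> f t"
    and t: "0 \<le> t"
  shows "f t = f 1 * t"
proof -
  have mono: "f s \<le> f r" if "0 \<le> s" "s \<le> r" for s r
    using add[of s "r - s"] nonneg[of "r - s"] that by simp
  have f0: "f 0 = 0" using add[of 0 0] by simp
  have mult: "f (real m * s) = real m * f s" if "0 \<le> s" for m s
  proof (induction m)
    case (Suc m)
    then show ?case using add[of s "real m * s"] that by (simp add: algebra_simps)
  qed (simp add: f0)
  have f_nat: "f (real m) = real m * f 1" for m
    using mult[of 1 m] by simp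
  have bound: "real m * \<bar>f t - f 1 * t\<bar> \<le> f 1" for m
  proof -
    define k where "k = nat \<lfloor>real m * t\<rfloor>"
    have k: "real k \<le> real m * t" "real m * t \<le> real k + 1"
      using t unfolding k_def by (auto simp: of_nat_floor)
    have "real k * f 1 \<le> real m * f t" "real m * f t \<le> (real k + 1) * f 1"
      using mono[OF _ k(1)] mono[OF _ k(2)] mult[OF t, of m] f_nat[of k] f_nat[of "Suc k"] t
      by (auto simp: add.commute)
    moreover have "real k * f 1 \<le> real m * t * f 1" "real m * t * f 1 \<le> (real k + 1) * f 1"
      using k nonneg[of 1] by (auto intro: mult_right_mono)
    ultimately have "\<bar>real m * f t - real m * t * f 1\<bar> \<le> f 1"
      by (simp add: algebra_simps abs_le_iff)
    moreover have "real m * f t - real m * t * f 1 = real m * (f t - f 1 * t)"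
      by (simp add: algebra_simps)
    ultimately show ?thesis by (simp add: abs_mult)
  qed
  show ?thesis
  proof (rule ccontr)
    assume "f t \<noteq> f 1 * t"
    then obtain m where "f 1 < real m * \<bar>f t - f 1 * t\<bar>"
      using reals_Archimedean3[of "\<bar>f t - f 1 * t\<bar>"] by auto
    with bound[of m] show False by simp
  qed
qed

text \<open>
  A spacelike \<open>v\<close> is the inner normal of the half-space of all \<open>x\<close> in \<open>future\<close> with \<open>\<langle>x,v\<rangle> > 0\<close>.
\<close>

definition separates :: "'n::{finite,linorder} rvec \<Rightarrow> 'n rvec \<Rightarrow> 'n rvec \<Rightarrow> bool" where
  "separates v x y \<longleftrightarrow> (0 < lorentz x v) \<noteq> (0 < lorentz y v)"

context
  assumes card: "2 \<le> CARD('n::{finite,linorder})"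
begin

text \<open>
  Two-point homogeneity, by at most two reflections: one moves \<open>x\<close> to \<open>e\<^sub>0\<close>, and one in a vector
  orthogonal to \<open>e\<^sub>0\<close> then turns the spatial part of the second point into the direction of \<open>e\<^sub>n\<close>.
\<close>

lemma reflection_invariant_eq_ray:
  fixes F :: "'n rvec \<Rightarrow> 'n rvec \<Rightarrow> 'b"
  assumes inv: "\<And>u x y. 0 < lorentz u u \<Longrightarrow> x \<in> future \<Longrightarrow> y \<in> future \<Longrightarrow>
      F (reflect u x) (reflect u y) = F x y"
    and x: "x \<in> future" and y: "y \<in> future"
  shows "F x y = F (ray 0) (ray (arcosh (- lorentz x y)))"
proof -
  obtain w where w: "w \<in> future" "F x y = F e_first w" "lorentz e_first w = lorentz x y"
  proof (cases "x = e_first")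
    case False
    \<comment> \<open>\<open>\<langle>x - e\<^sub>0, x - e\<^sub>0\<rangle> = 2 x\<^sup>0 - 2\<close>, and \<open>x\<^sup>0 = 1\<close> only for \<open>x = e\<^sub>0\<close>.\<close>
    have "0 < lorentz (x - e_first) (x - e_first)"
    proof -
      have "x $ idx_first \<ge> 1"
        using future_lorentz_le[OF x e_first_future] by simp
      moreover have "x $ idx_first \<noteq> 1"
      proof
        assume 1: "x $ idx_first = 1"
        then have "spatial x = 0" using x by (simp add: future_def lorentz_self)
        then show False using 1 False by (simp add: spatial_def)
      qed
      ultimately show ?thesis using x by (simp add: future_def)
    qed
    moreover from this have "reflect (x - e_first) x = e_first"
      using x e_first_future by (intro reflect_swap) (simp_all add: future_def)
    ultimately show ?thesis
      using that[of "reflect (x - e_first) y"] inv[of "x - e_first" x y] x y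
        reflect_future[of "x - e_first" y] lorentz_reflect_reflect[of "x - e_first" x y]
      by simp
  qed (use that y in auto)
  define r where "r = norm (spatial w)"
  define v where "v = (w $ idx_first) *\<^sub>R e_first + r *\<^sub>R (e_last :: 'n rvec)"
  have w_eq: "w = (w $ idx_first) *\<^sub>R e_first + spatial w"
    by (simp add: spatial_def)
  have "F e_first w = F e_first v"
  proof (cases "spatial w = r *\<^sub>R e_last")
    case True
    then show ?thesis using w_eq by (simp add: v_def)
  next
    case False
    define u where "u = spatial w - r *\<^sub>R e_last"
    have u_first: "u $ idx_first = 0"
      by (simp add: u_def axis_first_last[OF card])
    then have "lorentz u u = u \<bullet> u" by (simp add: lorentz_eq_inner)
    then have u: "0 < lorentz u u" using False by (simp add: u_def)
    have "lorentz (spatial w) (spatial w) = r\<^sup>2"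
      by (simp add: lorentz_eq_inner r_def dot_square_norm)
    then have "reflect u (spatial w) = r *\<^sub>R e_last"
      unfolding u_def using u
      by (intro reflect_swap)
        (simp_all add: u_def lorentz_e_last[OF card] axis_first_last[OF card] power2_eq_square)
    moreover have "reflect u e_first = e_first"
      by (simp add: reflect_def u_first)
    ultimately have "reflect u w = v"
      by (subst w_eq) (simp add: v_def linear_add linear_scale linear_reflect)
    then show ?thesis
      using inv[OF u e_first_future w(1)] \<open>reflect u e_first = e_first\<close> by simp
  qed
  moreover have "v = ray (arcosh (- lorentz x y))"
  proof -
    define t where "t = arcosh (- lorentz x y)"
    have w0: "w $ idx_first = - lorentz x y" using w(3) by simp
    have cosh: "cosh t = w $ idx_first" and t: "0 \<le> t"
      using future_lorentz_le[OF x y] by (simp_all add: t_def w0)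
    have "(sinh t)\<^sup>2 = r\<^sup>2"
      using w(1) by (simp add: sinh_square_eq cosh r_def future_def lorentz_self)
    then have "sinh t = r"
      using t by (simp add: r_def power2_eq_iff_nonneg)
    then show ?thesis by (simp add: v_def ray_def cosh flip: t_def)
  qed
  ultimately show ?thesis using w(2) by simp
qed

text \<open>
  By two-point homogeneity \<open>F\<close> is a function \<open>\<phi>\<close> of the distance. Evaluating it along the standard
  geodesic turns additivity of \<open>F\<close> into Cauchy's functional equation for \<open>\<phi>\<close> on the nonnegative reals.
  The constant may still be \<open>0\<close>.
\<close>

lemma geodesically_additive_eq_distance:
  fixes F :: "'n rvec \<Rightarrow> 'n rvec \<Rightarrow> ennreal"
  assumes inv: "\<And>u x y. 0 < lorentz u u \<Longrightarrow> x \<in> future \<Longrightarrow> y \<in> future \<Longrightarrow>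
      F (reflect u x) (reflect u y) = F x y"
    and add: "\<And>x y z a b. x \<in> future \<Longrightarrow> y \<in> future \<Longrightarrow> z \<in> future \<Longrightarrow> 0 \<le> a \<Longrightarrow> 0 \<le> b \<Longrightarrow>
      y = a *\<^sub>R x + b *\<^sub>R z \<Longrightarrow> F x z = F x y + F y z"
    and fin: "\<And>x y. x \<in> future \<Longrightarrow> y \<in> future \<Longrightarrow> F x y < \<infinity>"
  shows "\<exists>c\<ge>0. \<forall>x\<in>future. \<forall>y\<in>future. F x y = ennreal (c * hyp_dist (span {x}) (span {y}))"
proof -
  define \<phi> where "\<phi> t = enn2real (F (ray 0) (ray t))" for t
  note rays = ray_future[OF card]
  have F_eq: "F x y = ennreal (\<phi> (arcosh (- lorentz x y)))" if "x \<in> future" "y \<in> future" for x y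
    using reflection_invariant_eq_ray[of F, OF inv that] fin[OF rays[of 0] rays[of "arcosh (- lorentz x y)"]]
    by (simp add: \<phi>_def ennreal_enn2real)
  have nonneg: "0 \<le> \<phi> t" for t by (simp add: \<phi>_def)
  have "\<phi> (s + t) = \<phi> s + \<phi> t" if st: "0 \<le> s" "0 \<le> t" for s t
  proof -
    have "\<exists>a b. 0 \<le> a \<and> 0 \<le> b \<and> (ray s :: 'n rvec) = a *\<^sub>R ray 0 + b *\<^sub>R ray (s + t)"
    proof (cases "s + t = 0")
      case True
      then have "s = 0" using st by simp
      then show ?thesis by (intro exI[of _ 1] exI[of _ 0]) simp
    next
      case False
      then show ?thesis
        using ray_between[OF card, of s "s + t"] st
        by (intro exI[of _ "sinh t / sinh (s + t)"] exI[of _ "sinh s / sinh (s + t)"]) simp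
    qed
    then have "F (ray 0) (ray (s + t)) = F (ray 0) (ray s) + F (ray s) (ray (s + t))"
      using add[OF rays rays rays] by blast
    also have "F (ray s) (ray (s + t)) = F (ray 0) (ray t)"
      using F_eq[OF rays[of s] rays[of "s + t"]] F_eq[OF rays[of 0] rays[of t]] st
      by (simp only: lorentz_ray[OF card]) (simp add: arcosh_cosh_real)
    finally show ?thesis
      using fin[OF rays[of 0] rays[of s]] fin[OF rays[of 0] rays[of t]]
      by (simp add: \<phi>_def enn2real_plus)
  qed
  then have lin: "\<phi> t = \<phi> 1 * t" if "0 \<le> t" for t
    using additive_nonneg_linear[of \<phi>] nonneg that by blast
  show ?thesis
  proof (intro exI[of _ "\<phi> 1"] conjI ballI)
    fix x y :: "'n rvec" assume xy: "x \<in> future" "y \<in> future"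
    then have "0 \<le> arcosh (- lorentz x y)"
      using future_lorentz_le[OF xy] by simp
    then show "F x y = ennreal (\<phi> 1 * hyp_dist (span {x}) (span {y}))"
      using F_eq[OF xy] lin[of "arcosh (- lorentz x y)"] by (simp add: hyp_dist_future[OF xy])
  qed (rule nonneg)
qed

text \<open>
  The half-space with inner normal \<open>v\<close> is nonempty. The witness is \<open>P e\<^sub>0 + r v'\<close>, where \<open>v'\<close> is the
  spatial part of \<open>v\<close> and \<open>P = |v'|\<^sup>2\<close>: it is timelike if \<open>r\<^sup>2 < P\<close>, and its product with \<open>v\<close> is
  \<open>P (r - v\<^sup>0)\<close>. An \<open>r\<close> between \<open>|v\<^sup>0|\<close> and \<open>|v'|\<close> exists because \<open>v\<close> is spacelike.
\<close>

lemma exists_future_lorentz_pos: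
  fixes v :: "'n rvec"
  assumes v: "0 < lorentz v v"
  shows "\<exists>x. lorentz x x < 0 \<and> 0 < x $ idx_first \<and> 0 < lorentz x v"
proof -
  define P where "P = (norm (spatial v))\<^sup>2"
  define r where "r = (\<bar>v $ idx_first\<bar> + sqrt P) / 2"
  have "(v $ idx_first)\<^sup>2 < P" using v by (simp add: P_def lorentz_self)
  then have lt: "\<bar>v $ idx_first\<bar> < sqrt P" and P: "0 < P"
    using real_less_rsqrt by (auto intro: real_less_rsqrt le_less_trans[OF zero_le_power2])
  then have r: "\<bar>v $ idx_first\<bar> < r" "r < sqrt P" "0 \<le> r" by (auto simp: r_def)
  define x where "x = P *\<^sub>R e_first + r *\<^sub>R spatial v"
  have x0: "x $ idx_first = P" and sx: "spatial x = r *\<^sub>R spatial v"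
    by (simp_all add: x_def axis_first_last[OF card]) (simp add: spatial_def axis_first_last[OF card])
  have "r\<^sup>2 < P"
    using r P by (metis power_strict_mono real_sqrt_pow2 less_imp_le zero_less_numeral)
  then have "lorentz x x < 0"
    using P by (simp add: lorentz_self x0 sx power_mult_distrib P_def[symmetric] power2_eq_square[of P])
  moreover have "lorentz x v = P * (r - v $ idx_first)"
    by (simp add: lorentz_eq_spatial x0 sx dot_square_norm algebra_simps flip: P_def)
  ultimately show ?thesis using P r x0 by (intro exI[of _ x]) auto
qed

text \<open>
  A half-space and its complement both have interior points, so pairs from a countable dense set
  suffice. Hence a measure on half-spaces for which every pair of points is separated by a null set
  vanishes altogether; this excludes the constant \<open>0\<close>.
\<close>

lemma countable_separating_set:
  obtains D :: "'n rvec set" where "countable D" "D \<subseteq> future"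
    "\<And>v. 0 < lorentz v v \<Longrightarrow> \<exists>x\<in>D. \<exists>y\<in>D. separates v x y"
proof -
  obtain E :: "'n rvec set" where E: "countable E" "\<And>X. open X \<Longrightarrow> X \<noteq> {} \<Longrightarrow> \<exists>d\<in>E. d \<in> X"
    by (rule countable_dense_setE) blast
  define D where "D = (\<lambda>x. (1 / sqrt (- lorentz x x)) *\<^sub>R x) ` {x\<in>E. lorentz x x < 0 \<and> 0 < x $ idx_first}"
  have pos: "\<exists>x\<in>D. 0 < lorentz x v" if v: "0 < lorentz v v" for v
  proof -
    have "open {x :: 'n rvec. lorentz x x < 0 \<and> 0 < x $ idx_first \<and> 0 < lorentz x v}"
      by (intro open_Collect_conj open_Collect_less continuous_intros)
    moreover have "{x :: 'n rvec. lorentz x x < 0 \<and> 0 < x $ idx_first \<and> 0 < lorentz x v} \<noteq> {}"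
      using exists_future_lorentz_pos[OF v] by auto
    ultimately obtain x where "x \<in> E" "lorentz x x < 0" "0 < x $ idx_first" "0 < lorentz x v"
      using E(2) by (smt (verit) mem_Collect_eq)
    then show ?thesis
      by (intro bexI[of _ "(1 / sqrt (- lorentz x x)) *\<^sub>R x"]) (auto simp: D_def)
  qed
  show ?thesis
  proof (rule that)
    show "countable D" using E(1) by (simp add: D_def)
    show "D \<subseteq> future" using normalize_timelike by (auto simp: D_def)
    fix v :: "'n rvec" assume v: "0 < lorentz v v"
    obtain x y where "x \<in> D" "y \<in> D" "0 < lorentz x v" "0 < lorentz y (- v)"
      using pos[of v] pos[of "- v"] v by auto
    then show "\<exists>x\<in>D. \<exists>y\<in>D. separates v x y"
      by (intro bexI[of _ x] bexI[of _ y]) (auto simp: separates_def)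
  qed
qed

text \<open>
  Half-spaces and their complements are geodesically convex: a hyperplane that separates the ends of
  a segment crosses it once, so it separates an intermediate point from exactly one of them.
\<close>

lemma separates_between:
  assumes "x \<in> future" "y \<in> future" "z \<in> future" "0 \<le> a" "0 \<le> b"
    and y: "y = a *\<^sub>R x + b *\<^sub>R z"
  shows "separates v x z \<longleftrightarrow> separates v x y \<or> separates v y z"
    and "\<not> (separates v x y \<and> separates v y z)"
proof -
  have ab: "0 < a \<or> 0 < b" 
  proof (rule ccontr)
    assume "\<not> (0 < a \<or> 0 < b)"
    then have "y = 0" using assms by simp
    then show False using assms(2) by (simp add: future_def)
  qed
  have "lorentz y v = a * lorentz x v + b * lorentz z v" by (simp add: y)
  moreover have "0 < a * lorentz x v + b * lorentz z v" if "0 < lorentz x v" "0 < lorentz z v"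
    using that ab assms(4,5) by (smt (verit) mult_nonneg_nonneg mult_pos_pos)
  moreover have "a * lorentz x v + b * lorentz z v \<le> 0" if "lorentz x v \<le> 0" "lorentz z v \<le> 0"
    using that assms(4,5) by (smt (verit) mult_nonneg_nonpos)
  ultimately show "separates v x z \<longleftrightarrow> separates v x y \<or> separates v y z"
    and "\<not> (separates v x y \<and> separates v y z)"
    unfolding separates_def by linarith+
qed

text \<open>
  The hyperplane orthogonal to a separating \<open>v\<close> contains a point \<open>p = a x + b y\<close> with \<open>a + b = 1\<close> of the
  chord. The chord lies inside the hyperboloid, \<open>\<langle>p,p\<rangle> \<le> -1\<close>, and \<open>p\<^sup>0 v\<^sup>0\<close> is the inner product of
  the spatial parts of \<open>p\<close> and \<open>v\<close>; Cauchy-Schwarz then bounds \<open>|v\<^sup>0|\<close> by the spatial norm of \<open>p\<close>.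
\<close>

lemma separates_bounded:
  assumes x: "x \<in> future" and y: "y \<in> future"
  obtains R where "\<And>v. lorentz v v \<le> 1 \<Longrightarrow> separates v x y \<Longrightarrow> norm v \<le> R"
proof -
  define m where "m = norm (spatial x) + norm (spatial y)"
  define R where "R = sqrt (1 + 2 * m\<^sup>2)"
  have key: "norm v \<le> R" if v: "lorentz v v \<le> 1" and ab: "0 \<le> a" "0 \<le> b" "a + b = 1"
      and zero: "lorentz (a *\<^sub>R x + b *\<^sub>R y) v = 0" for v a b
  proof -
    define p where "p = a *\<^sub>R x + b *\<^sub>R y"
    have "lorentz p p = - (a\<^sup>2) - b\<^sup>2 + 2 * a * b * lorentz x y"
      using x y unfolding future_def p_def
      by (simp add: lorentz_commute[of y x] power2_eq_square algebra_simps)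
    also have "\<dots> \<le> - (a\<^sup>2) - b\<^sup>2 + 2 * a * b * (- 1)"
      using ab future_lorentz_le[OF x y] by (intro add_left_mono mult_left_mono) auto
    also have "\<dots> = - ((a + b)\<^sup>2)" by (simp add: power2_sum)
    finally have pp: "lorentz p p \<le> - 1" using ab by simp
    have sp: "norm (spatial p) \<le> m"
    proof -
      have "spatial p = a *\<^sub>R spatial x + b *\<^sub>R spatial y"
        by (simp add: p_def spatial_def algebra_simps)
      then have "norm (spatial p) \<le> a * norm (spatial x) + b * norm (spatial y)"
        using ab norm_triangle_ineq[of "a *\<^sub>R spatial x" "b *\<^sub>R spatial y"] by simp
      also have "\<dots> \<le> 1 * norm (spatial x) + 1 * norm (spatial y)"
        using ab by (intro add_mono mult_right_mono) auto
      finally show ?thesis by (simp add: m_def)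
    qed
    have "p $ idx_first * v $ idx_first = spatial p \<bullet> spatial v"
      using zero by (simp add: lorentz_eq_spatial flip: p_def)
    then have "(p $ idx_first * v $ idx_first)\<^sup>2 \<le> (norm (spatial p) * norm (spatial v))\<^sup>2"
      using Cauchy_Schwarz_ineq2[of "spatial p" "spatial v"] by (metis abs_le_square_iff abs_mult abs_norm_cancel)
    also have "\<dots> \<le> (norm (spatial p))\<^sup>2 * (1 + (v $ idx_first)\<^sup>2)"
      using v by (simp add: power_mult_distrib lorentz_self mult_left_mono)
    finally have "- lorentz p p * (v $ idx_first)\<^sup>2 \<le> (norm (spatial p))\<^sup>2"
      by (simp add: lorentz_self power_mult_distrib algebra_simps)
    moreover have "1 * (v $ idx_first)\<^sup>2 \<le> - lorentz p p * (v $ idx_first)\<^sup>2"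
      using pp by (intro mult_right_mono) auto
    moreover have "(norm (spatial p))\<^sup>2 \<le> m\<^sup>2"
      using sp by (intro power_mono) auto
    ultimately have "(v $ idx_first)\<^sup>2 \<le> m\<^sup>2" by linarith
    then have "(norm v)\<^sup>2 \<le> 1 + 2 * m\<^sup>2"
      using v norm_eq_spatial[of v] by (simp add: lorentz_self)
    then show ?thesis by (simp add: R_def real_le_rsqrt)
  qed
  show ?thesis
  proof (rule that)
    fix v assume v: "lorentz v v \<le> 1" and sep: "separates v x y"
    define s where "s = lorentz x v - lorentz y v"
    have s: "s \<noteq> 0" using sep by (auto simp: separates_def s_def)
    have r: "0 \<le> - lorentz y v / s" "0 \<le> lorentz x v / s"
      using sep by (auto simp: separates_def s_def zero_le_divide_iff divide_le_0_iff)
    have "- lorentz y v / s + lorentz x v / s = (lorentz x v - lorentz y v) / s"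
      by (simp add: diff_divide_distrib)
    also have "\<dots> = 1" using s by (simp flip: s_def)
    finally have "- lorentz y v / s + lorentz x v / s = 1" .
    moreover have "lorentz ((- lorentz y v / s) *\<^sub>R x + (lorentz x v / s) *\<^sub>R y) v = 0"
      by simp
    ultimately show "norm v \<le> R" using key[OF v r] by blast
  qed
qed

end

section \<open>Negative type from an invariant measure on normals\<close>

lemma open_null_set_lborel_empty:
  fixes W :: "'a::euclidean_space set"
  assumes "open W" "W \<in> null_sets lborel"
  shows "W = {}"
  using null_sets_completionI[OF assms(2)] assms(1) open_not_negligible[of W]
  by (auto simp: negligible_iff_null_sets)

text \<open>
  Write \<open>\<lambda>\<close> for Lebesgue measure. Integrating \<open>1\<^sub>A (T x) 1\<^sub>B (T x + y)\<close> over \<open>x\<close> and \<open>y\<close> in the two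
  possible orders, and using that \<open>\<lambda>\<close> is invariant under translations and under \<open>x \<mapsto> -x\<close>, gives
  \<open>\<lambda>(T\<^sup>-\<^sup>1 A) \<lambda>(B) = \<lambda>(T\<^sup>-\<^sup>1 B) \<lambda>(A)\<close>. For an involution there is a bounded open \<open>A\<close> with
  \<open>T\<^sup>-\<^sup>1 A = A\<close>, and the factor \<open>\<lambda>(A)\<close> cancels.
\<close>

lemma emeasure_lborel_linear_involution:
  fixes T :: "'a::euclidean_space \<Rightarrow> 'a"
  assumes T: "linear T" "\<And>x. T (T x) = x" and B: "B \<in> sets borel"
  shows "emeasure lborel (T -` B) = emeasure lborel B"
proof -
  have cont: "continuous_on UNIV T"
    using T(1) by (simp add: linear_continuous_on linear_conv_bounded_linear)
  have T_meas [measurable]: "T \<in> borel_measurable borel"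
    using cont by (rule borel_measurable_continuous_onI)
  have vimage [measurable]: "T -` A \<in> sets borel" if "A \<in> sets borel" for A
    using measurable_sets_borel[OF T_meas that] by simp
  have shift: "(\<integral>\<^sup>+ x. f (a + x) \<partial>lborel) = (\<integral>\<^sup>+ x. f x \<partial>lborel)"
    if [measurable]: "f \<in> borel_measurable borel" for f :: "'a \<Rightarrow> ennreal" and a
    by (subst (2) lborel_distr_plus[of a, symmetric]) (simp add: nn_integral_distr)
  have flip: "(\<integral>\<^sup>+ x. f (a - x) \<partial>lborel) = (\<integral>\<^sup>+ x. f x \<partial>lborel)"
    if [measurable]: "f \<in> borel_measurable borel" for f :: "'a \<Rightarrow> ennreal" and a
    by (subst (2) lborel_affine[of "-1" a]) (simp_all add: nn_integral_density nn_integral_distr)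
  have exchange: "emeasure lborel (T -` A) * emeasure lborel B = emeasure lborel (T -` B) * emeasure lborel A"
    if [measurable]: "A \<in> sets borel" "B \<in> sets borel" for A B
  proof -
    let ?I = "\<lambda>A x. indicator A x :: ennreal"
    have vI: "(\<integral>\<^sup>+ x. ?I A (T x) \<partial>lborel) = emeasure lborel (T -` A)"
      if [measurable]: "A \<in> sets borel" for A
    proof -
      have "(\<integral>\<^sup>+ x. ?I A (T x) \<partial>lborel) = (\<integral>\<^sup>+ x. ?I (T -` A) x \<partial>lborel)"
        by (intro nn_integral_cong) (simp add: indicator_def)
      then show ?thesis by simp
    qed
    have "emeasure lborel (T -` A) * emeasure lborel B
        = (\<integral>\<^sup>+ x. ?I A (T x) * (\<integral>\<^sup>+ y. ?I B (T x + y) \<partial>lborel) \<partial>lborel)"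
      by (simp add: shift nn_integral_multc vI)
    also have "\<dots> = (\<integral>\<^sup>+ x. \<integral>\<^sup>+ y. ?I A (T x) * ?I B (T x + y) \<partial>lborel \<partial>lborel)"
      by (simp add: nn_integral_cmult)
    also have "\<dots> = (\<integral>\<^sup>+ y. \<integral>\<^sup>+ x. ?I A (T x) * ?I B (T x + y) \<partial>lborel \<partial>lborel)"
      by (rule lborel_pair.Fubini'[symmetric]) measurable
    \<comment> \<open>Translating \<open>x\<close> by \<open>- T y\<close> replaces \<open>T x\<close> by \<open>T x - y\<close>, since \<open>T (T y) = y\<close>.\<close>
    also have "\<dots> = (\<integral>\<^sup>+ y. \<integral>\<^sup>+ x. ?I A (T (- T y + x)) * ?I B (T (- T y + x) + y) \<partial>lborel \<partial>lborel)"
      by (intro nn_integral_cong shift[symmetric]) measurable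
    also have "\<dots> = (\<integral>\<^sup>+ y. \<integral>\<^sup>+ x. ?I A (T x - y) * ?I B (T x) \<partial>lborel \<partial>lborel)"
      by (simp add: linear_diff[OF T(1)] T(2))
    also have "\<dots> = (\<integral>\<^sup>+ x. \<integral>\<^sup>+ y. ?I A (T x - y) * ?I B (T x) \<partial>lborel \<partial>lborel)"
      by (rule lborel_pair.Fubini') measurable
    also have "\<dots> = (\<integral>\<^sup>+ x. (\<integral>\<^sup>+ y. ?I A (T x - y) \<partial>lborel) * ?I B (T x) \<partial>lborel)"
      by (simp add: nn_integral_multc)
    also have "\<dots> = emeasure lborel (T -` B) * emeasure lborel A"
      by (simp add: flip nn_integral_cmult vI mult.commute)
    finally show ?thesis .
  qed
  define A where "A = ball 0 1 \<inter> T -` ball 0 1"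
  have "open A"
    unfolding A_def using cont by (intro open_Int open_ball open_vimage)
  moreover have "0 \<in> A" using linear_0[OF T(1)] by (simp add: A_def)
  ultimately have "emeasure lborel A \<noteq> 0"
    using open_null_set_lborel_empty[of A] by (auto simp: null_sets_def)
  moreover have "emeasure lborel A < \<infinity>"
    by (rule emeasure_bounded_finite) (auto simp: A_def)
  moreover have "T -` A = A" using T(2) by (auto simp: A_def)
  moreover have "A \<in> sets borel" using \<open>open A\<close> by simp
  ultimately show ?thesis
    using exchange[OF _ B, of A] by (auto simp: mult.commute ennreal_mult_cancel_left)
qed

text \<open>
  For real weights \<open>t\<close> of sum zero, the identity \<open>1\<^bsub>A \<triangle> B\<^esub> = 1\<^sub>A + 1\<^sub>B - 2 1\<^sub>A 1\<^sub>B\<close> makes the quadratic form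
  the integral of \<open>-2 (\<Sum> t\<^sub>p 1\<^bsub>A p\<^esub>)\<^sup>2\<close>. Only the symmetric differences have finite measure in the
  application, so the sum has to be formed pointwise before integrating. The triangle inequality
  comes from \<open>A \<triangle> C \<subseteq> (A \<triangle> B) \<union> (B \<triangle> C)\<close>.
\<close>

lemma kernel_of_negative_type_measure:
  fixes X :: "'a set" and M :: "'b measure"
  assumes d: "\<And>p q. p \<in> X \<Longrightarrow> q \<in> X \<Longrightarrow> d p q = k * measure M (sym_diff (A p) (A q))"
    and k: "0 \<le> k"
    and A: "\<And>p q. p \<in> X \<Longrightarrow> q \<in> X \<Longrightarrow> sym_diff (A p) (A q) \<in> fmeasurable M"
  shows "kernel_of_negative_type X d"
  unfolding kernel_of_negative_type_def
proof (intro conjI allI impI)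
  let ?S = "\<lambda>p q. sym_diff (A p) (A q)"
  have "measure M (sym_diff (A p) (A r)) \<le> measure M (sym_diff (A p) (A q)) + measure M (sym_diff (A q) (A r))"
    if "p \<in> X" "q \<in> X" "r \<in> X" for p q r
  proof -
    have S: "?S p r \<in> fmeasurable M" "?S p q \<in> fmeasurable M" "?S q r \<in> fmeasurable M"
      using A that by auto
    have "measure M (?S p r) \<le> measure M (?S p q \<union> ?S q r)"
      by (rule measure_mono_fmeasurable[OF _ fmeasurableD[OF S(1)] fmeasurable.Un[OF S(2,3)]]) auto
    also have "\<dots> \<le> measure M (?S p q) + measure M (?S q r)"
      by (rule measure_Un_le[OF fmeasurableD[OF S(2)] fmeasurableD[OF S(3)]])
    finally show ?thesis .
  qed
  then show "semimetric_on X d"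
    using k unfolding semimetric_on_def by (auto simp: d Un_commute simp flip: distrib_left intro!: mult_left_mono)
next
  fix F and t :: "'a \<Rightarrow> real"
  assume F: "finite F \<and> F \<subseteq> X \<and> sum t F = 0"
  let ?S = "\<lambda>p q. sym_diff (A p) (A q)"
  let ?g = "\<lambda>v. \<Sum>p\<in>F. \<Sum>q\<in>F. t p * t q * indicat_real (?S p q) v"
  have int: "integrable M (indicat_real (?S p q))" and meas: "measure M (?S p q) = (\<integral>v. indicat_real (?S p q) v \<partial>M)"
    if "p \<in> F" "q \<in> F" for p q
  proof -
    have S: "?S p q \<in> fmeasurable M" using A F that by blast
    then show "integrable M (indicat_real (?S p q))"
      by (auto simp: fmeasurable_def)
    show "measure M (?S p q) = (\<integral>v. indicat_real (?S p q) v \<partial>M)"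
      using sets.sets_into_space[OF fmeasurableD[OF S]] by (simp add: Int_absorb2)
  qed
  have "(\<Sum>p\<in>F. \<Sum>q\<in>F. t p * t q * measure M (?S p q)) = (\<integral>v. ?g v \<partial>M)"
    using int by (simp add: meas)
  also have "\<dots> \<le> (\<integral>v. 0 \<partial>M)"
  proof (rule integral_mono)
    show "integrable M ?g" using int by auto
    fix v
    define f where "f p = indicat_real (A p) v" for p
    have "?g v = (\<Sum>p\<in>F. \<Sum>q\<in>F. t p * f p * t q + t p * (t q * f q) - 2 * ((t p * f p) * (t q * f q)))"
      by (intro sum.cong refl) (auto simp: f_def indicator_def)
    also have "\<dots> = (\<Sum>p\<in>F. t p * f p) * sum t F + sum t F * (\<Sum>q\<in>F. t q * f q)
        - 2 * ((\<Sum>p\<in>F. t p * f p) * (\<Sum>q\<in>F. t q * f q))"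
      unfolding sum_product by (simp only: sum.distrib sum_subtractf sum_distrib_left)
    also have "\<dots> \<le> 0" using F by simp
    finally show "?g v \<le> 0" .
  qed simp
  finally have "(\<Sum>p\<in>F. \<Sum>q\<in>F. t p * t q * measure M (?S p q)) \<le> 0" by simp
  moreover have "(\<Sum>p\<in>F. \<Sum>q\<in>F. t p * t q * d p q) = k * (\<Sum>p\<in>F. \<Sum>q\<in>F. t p * t q * measure M (?S p q))"
    unfolding sum_distrib_left using F by (intro sum.cong refl) (auto simp: d subset_iff)
  ultimately show "(\<Sum>p\<in>F. \<Sum>q\<in>F. t p * t q * d p q) \<le> 0"
    using k by (simp add: mult_nonneg_nonpos)
qed

context
  assumes card: "2 \<le> CARD('n::{finite,linorder})"
begin

text \<open>
  An explicit invariant measure shows that the distance is of negative type: Lebesgue measure on the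
  shell \<open>0 < \<langle>v,v\<rangle> < 1\<close> of inner normals of half-spaces. The measure of the normals that separate
  two points is invariant under reflections and additive along geodesics, hence a positive multiple
  of the distance.
\<close>

lemma kernel_of_negative_type_hyp_dist:
  "kernel_of_negative_type (hyp_space :: ('n rvec) set set) hyp_dist"
proof -
  define S :: "'n rvec \<Rightarrow> 'n rvec \<Rightarrow> 'n rvec set" where
    "S x y = {v. 0 < lorentz v v \<and> lorentz v v < 1 \<and> separates v x y}" for x y
  define H :: "'n rvec \<Rightarrow> 'n rvec set" where
    "H x = {v. 0 < lorentz v v \<and> lorentz v v < 1 \<and> 0 < lorentz x v}" for x
  have S_eq: "S x y = sym_diff (H x) (H y)" for x y
    by (auto simp: S_def H_def separates_def)
  have "open (H x)" for x
    unfolding H_def by (intro open_Collect_conj open_Collect_less continuous_intros)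
  then have S_sets [measurable]: "S x y \<in> sets borel" for x y
    unfolding S_eq by (intro sets.Un sets.Diff borel_open)
  have S_finite: "emeasure lborel (S x y) < \<infinity>" if xy: "x \<in> future" "y \<in> future" for x y
  proof -
    obtain R where "\<And>v. lorentz v v \<le> 1 \<Longrightarrow> separates v x y \<Longrightarrow> norm v \<le> R"
      using separates_bounded[OF card xy] by blast
    then have "bounded (S x y)"
      by (intro boundedI[of _ R]) (auto simp: S_def)
    then show ?thesis by (rule emeasure_bounded_finite)
  qed
  have refl: "emeasure lborel (S (reflect u x) (reflect u y)) = emeasure lborel (S x y)"
    if u: "0 < lorentz u u" and "x \<in> future" "y \<in> future" for u x y
  proof -
    have "S (reflect u x) (reflect u y) = reflect u -` S x y"
      using u by (auto simp: S_def separates_def lorentz_reflect)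
    then show ?thesis
      using u emeasure_lborel_linear_involution[of "reflect u" "S x y"] by (simp add: linear_reflect)
  qed
  have add: "emeasure lborel (S x z) = emeasure lborel (S x y) + emeasure lborel (S y z)"
    if "x \<in> future" "y \<in> future" "z \<in> future" "0 \<le> a" "0 \<le> b" "y = a *\<^sub>R x + b *\<^sub>R z"
    for x y z a b
  proof -
    have "S x z = S x y \<union> S y z" "S x y \<inter> S y z = {}"
      using separates_between[OF card that] by (auto simp: S_def)
    then show ?thesis by (simp add: plus_emeasure)
  qed
  have "\<exists>c\<ge>0. \<forall>x\<in>future. \<forall>y\<in>future.
      emeasure lborel (S x y) = ennreal (c * hyp_dist (span {x}) (span {y}))"
    by (rule geodesically_additive_eq_distance[OF card, of "\<lambda>x y. emeasure lborel (S x y)"])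
      (fact refl add S_finite)+
  then obtain c where c: "0 \<le> c" and
    eq: "\<And>x y. x \<in> future \<Longrightarrow> y \<in> future \<Longrightarrow>
      emeasure lborel (S x y) = ennreal (c * hyp_dist (span {x}) (span {y}))"
    by blast
  have "c \<noteq> 0"
  proof
    assume "c = 0"
    then have null: "S x y \<in> null_sets lborel" if "x \<in> future" "y \<in> future" for x y
      using eq[OF that] by auto
    obtain D :: "'n rvec set" where D: "countable D" "D \<subseteq> future"
      "\<And>v. 0 < lorentz v v \<Longrightarrow> \<exists>x\<in>D. \<exists>y\<in>D. separates v x y"
      using countable_separating_set[OF card] by blast
    let ?W = "{v :: 'n rvec. 0 < lorentz v v \<and> lorentz v v < 1}"
    have "?W \<subseteq> (\<Union>x\<in>D. \<Union>y\<in>D. S x y)"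
      using D(3) by (auto simp: S_def)
    moreover have "(\<Union>x\<in>D. \<Union>y\<in>D. S x y) \<in> null_sets lborel"
      using D(1,2) null by (intro null_sets_UN') auto
    moreover have W: "open ?W"
      by (intro open_Collect_conj open_Collect_less continuous_intros)
    ultimately have "?W \<in> null_sets lborel"
      using null_sets_subset[of _ lborel ?W] by simp
    then have "?W = {}"
      using W by (rule open_null_set_lborel_empty[rotated])
    moreover have "(1/2) *\<^sub>R e_last \<in> ?W"
      by (simp add: lorentz_e_last[OF card] axis_first_last[OF card])
    ultimately show False by blast
  qed
  with c have c: "0 < c" by simp
  define rep where "rep p = (SOME x. x \<in> future \<and> p = span {x})" for p :: "'n rvec set"
  have rep: "rep p \<in> future" "span {rep p} = p" if "p \<in> hyp_space" for p
  proof -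
    have "\<exists>x. x \<in> future \<and> p = span {x}" using that unfolding hyp_space_eq by blast
    from someI_ex[OF this] show "rep p \<in> future" "span {rep p} = p"
      by (simp_all add: rep_def)
  qed
  show ?thesis
  proof (rule kernel_of_negative_type_measure)
    fix p q :: "'n rvec set" assume pq: "p \<in> hyp_space" "q \<in> hyp_space"
    have "0 \<le> hyp_dist p q"
      using rep[OF pq(1)] rep[OF pq(2)] hyp_dist_span(1)[of "rep p" "rep q"] by (simp add: future_def)
    then have "measure lborel (S (rep p) (rep q)) = c * hyp_dist p q"
      using eq[of "rep p" "rep q"] rep pq c by (simp add: measure_def)
    then show "hyp_dist p q = 1 / c * measure lborel (sym_diff (H (rep p)) (H (rep q)))"
      using c by (simp add: S_eq)
    show "sym_diff (H (rep p)) (H (rep q)) \<in> fmeasurable lborel"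
      using S_finite[of "rep p" "rep q"] S_sets[of "rep p" "rep q"] rep pq
      by (intro fmeasurableI) (simp_all add: S_eq)
  qed (use c in simp)
qed

end

section \<open>The action on half-spaces\<close>

lemma lorentz_nondegenerate:
  assumes "\<And>w. lorentz z w = 0"
  shows "z = 0"
proof -
  have "spatial (spatial z) = spatial z" by (simp add: spatial_def[of "spatial z"])
  then have "lorentz z (spatial z - (z $ idx_first) *\<^sub>R e_first) = (norm z)\<^sup>2"
    by (simp add: lorentz_eq_spatial[of z "spatial z"] norm_eq_spatial[of z] dot_square_norm
        power2_eq_square[of "z $ _"])
  then have "(norm z)\<^sup>2 = 0" by (simp only: assms)
  then show ?thesis by simp
qed

lemma matrix_linear_works: "linear h \<Longrightarrow> matrix h *v x = h x" for h :: "real^'a \<Rightarrow> real^'b"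
  by (simp add: matrix_works linear_matrix_vector_mul_eq)

lemma matrix_in_O1n:
  assumes h: "linear h" and pres: "\<And>x y. lorentz (h x) (h y) = lorentz x y"
  shows "matrix h \<in> O1n"
proof -
  have works: "matrix h *v x = h x" for x
    using h by (rule matrix_linear_works)
  have "inj ((*v) (matrix h))"
  proof (rule injI)
    fix x y assume "matrix h *v x = matrix h *v y"
    then have "h (x - y) = 0" using h by (simp add: works linear_diff)
    then have "lorentz (x - y) w = 0" for w using pres[of "x - y" w] by simp
    then show "x = y" using lorentz_nondegenerate[of "x - y"] by simp
  qed
  then have "invertible (matrix h)"
    by (simp add: invertible_left_inverse matrix_left_invertible_injective)
  then show ?thesis by (simp add: O1n_def works pres)
qed

lemma lorentz_O1n: "g \<in> O1n \<Longrightarrow> lorentz (g *v x) (g *v y) = lorentz x y"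
  by (simp add: O1n_def)

lemma O1n_mult: "g \<in> O1n \<Longrightarrow> h \<in> O1n \<Longrightarrow> g ** h \<in> O1n"
  by (auto simp: O1n_def invertible_mult simp flip: matrix_vector_mul_assoc)

lemma pt_act_span: "pt_act g (span {x}) = span {g *v x}"
  unfolding pt_act_def using span_linear_image[OF matrix_vector_mul_linear, of g "{x}"] by simp

lemma pt_act_pt_act: "pt_act g (pt_act h p) = pt_act (g ** h) p"
  by (simp add: pt_act_def image_image matrix_vector_mul_assoc)

lemma set_act_set_act: "set_act g (set_act h H) = set_act (g ** h) H"
  by (simp add: set_act_def image_image pt_act_pt_act)

lemma set_act_half_space: "g \<in> O1n \<Longrightarrow> H \<in> half_spaces \<Longrightarrow> set_act g H \<in> half_spaces"
  by (auto simp: half_spaces_def set_act_set_act intro: O1n_mult)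

lemma half_space_subset: "H \<in> half_spaces \<Longrightarrow> H \<subseteq> hyp_space"
  by (fastforce simp: half_spaces_def set_act_def base_half_space_def hyp_space_def pt_act_span lorentz_O1n)

lemma half_space_eqI:
  assumes "H \<in> half_spaces" "K \<in> half_spaces"
    and "\<And>x. x \<in> future \<Longrightarrow> span {x} \<in> H \<longleftrightarrow> span {x} \<in> K"
  shows "H = K"
  using assms half_space_subset[OF assms(1)] half_space_subset[OF assms(2)] unfolding hyp_space_eq by blast

lemma continuous_on_matrix:
  assumes "\<And>x. continuous_on S (\<lambda>v. h v x)"
  shows "continuous_on S (\<lambda>v. matrix (h v))"
  unfolding matrix_def by (intro continuous_on_vec_lambda continuous_intros assms)

lemma continuous_on_reflect:
  assumes "continuous_on S f" "continuous_on S g" "\<And>v. v \<in> S \<Longrightarrow> lorentz (f v) (f v) \<noteq> 0"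
  shows "continuous_on S (\<lambda>v. reflect (f v) (g v))"
  unfolding reflect_def by (intro continuous_intros assms) (use assms(3) in auto)

text \<open>
  An involution is its own inverse, so the inclusion from left to right, applied to \<open>g p\<close>, also
  yields the converse. This is applied to reflections.
\<close>

lemma half_spaces_at_involution:
  assumes g: "g \<in> O1n" and inv: "g ** g = mat 1"
  shows "set_act g ` half_spaces_at p = half_spaces_at (pt_act g p)"
    and "inj (set_act g)"
proof -
  have pt: "pt_act g (pt_act g q) = q" for q
    by (simp add: pt_act_pt_act inv) (simp add: pt_act_def)
  have set: "set_act g (set_act g H) = H" for H
    by (simp add: set_act_def image_image pt)
  have mem: "pt_act g q \<in> set_act g H" if "q \<in> H" for q H
    using that by (simp add: set_act_def)
  show "inj (set_act g)" by (rule inj_on_inverseI) (rule set)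
  show "set_act g ` half_spaces_at p = half_spaces_at (pt_act g p)"
  proof (intro equalityI subsetI)
    fix H assume "H \<in> half_spaces_at (pt_act g p)"
    then have "set_act g H \<in> half_spaces_at p"
      using mem[of "pt_act g p" H] set_act_half_space[OF g] by (simp add: half_spaces_at_def pt)
    then show "H \<in> set_act g ` half_spaces_at p" using set[of H] by (metis imageI)
  qed (use mem set_act_half_space[OF g] in \<open>auto simp: half_spaces_at_def\<close>)
qed

lemma continuous_on_matrix_vector: "continuous_on S (\<lambda>g :: 'n::finite rmat. g *v w)"
  unfolding matrix_vector_mult_def by (intro continuous_intros)

section \<open>Normals and the topology of the space of half-spaces\<close>

definition half_space_normal :: "('n::{finite,linorder} rvec) set set \<Rightarrow> 'n rvec \<Rightarrow> bool" where
  "half_space_normal H v \<longleftrightarrow> lorentz v v = 1 \<and> (\<forall>x\<in>future. span {x} \<in> H \<longleftrightarrow> 0 < lorentz x v)"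

context
  assumes card: "2 \<le> CARD('n::{finite,linorder})"
begin

text \<open>
  Both \<open>y\<close> and \<open>-y\<close> span the line, so the condition on the representative with positive time
  coordinate becomes one on the sign of a product.
\<close>

lemma span_mem_base_half_space:
  fixes y :: "'n rvec"
  assumes "lorentz y y < 0"
  shows "span {y} \<in> base_half_space \<longleftrightarrow> 0 < y $ idx_first * y $ idx_last"
proof
  assume "span {y} \<in> base_half_space"
  then obtain z where z: "span {y} = span {z}" "0 < z $ idx_first" "0 < z $ idx_last"
    by (auto simp: base_half_space_def)
  then have "z \<in> span {y}" by (simp add: span_base)
  then obtain a where "z = a *\<^sub>R y" by (auto simp: span_singleton)
  moreover from this have "0 < a\<^sup>2 * (y $ idx_first * y $ idx_last)"
    using mult_pos_pos[OF z(2,3)] by (simp add: power2_eq_square algebra_simps)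
  ultimately show "0 < y $ idx_first * y $ idx_last"
    by (simp add: zero_less_mult_iff)
next
  assume "0 < y $ idx_first * y $ idx_last"
  then consider "0 < y $ idx_first" "0 < y $ idx_last" | "0 < (- y) $ idx_first" "0 < (- y) $ idx_last"
    by (auto simp: zero_less_mult_iff)
  moreover have "span {- y} = span {y}" using span_scale_eq[of "-1" y] by simp
  ultimately show "span {y} \<in> base_half_space"
    using assms unfolding base_half_space_def by cases (blast, metis (mono_tags, lifting) lorentz_linear(7,8) minus_minus mem_Collect_eq)
qed

text \<open>
  Moving \<open>x\<close> back by \<open>g\<^sup>-\<^sup>1\<close> and using that \<open>g\<close> preserves the form expresses membership polynomially in
  \<open>g\<close>; openness of the set of half-spaces containing \<open>x\<close> follows at once.
\<close>

lemma span_mem_half_space: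
  fixes x :: "'n rvec"
  assumes g: "g \<in> O1n" and x: "x \<in> future"
  shows "span {x} \<in> set_act g base_half_space
    \<longleftrightarrow> lorentz x (g *v e_first) * lorentz x (g *v e_last) < 0"
proof -
  have inv: "invertible g" using g by (simp add: O1n_def)
  then obtain g' where "g ** g' = mat 1" by (auto simp: invertible_def)
  define y where "y = g' *v x"
  have gy: "g *v y = x"
    using \<open>g ** g' = mat 1\<close> by (simp add: y_def matrix_vector_mul_assoc)
  have "inj ((*v) g)"
    using inv by (simp add: invertible_left_inverse matrix_left_invertible_injective)
  then have "inj (pt_act g)"
    by (intro injI) (simp add: pt_act_def inj_image_eq_iff)
  moreover have "span {x} = pt_act g (span {y})"
    by (simp add: pt_act_span gy)
  ultimately have "span {x} \<in> set_act g base_half_space \<longleftrightarrow> span {y} \<in> base_half_space"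
    by (simp add: set_act_def inj_image_mem_iff)
  also have "\<dots> \<longleftrightarrow> 0 < y $ idx_first * y $ idx_last"
    using lorentz_O1n[OF g, of y y] x by (intro span_mem_base_half_space) (simp add: gy future_def)
  also have "y $ idx_first = - lorentz x (g *v e_first)"
    using lorentz_O1n[OF g, of y e_first] by (simp add: gy)
  also have "y $ idx_last = lorentz x (g *v e_last)"
    using lorentz_O1n[OF g, of y e_last] by (simp add: gy lorentz_e_last[OF card])
  finally show ?thesis by (simp add: algebra_simps)
qed

text \<open>
  The sign depends on whether \<open>g\<close> preserves or exchanges the two halves of the light cone.
\<close>

lemma half_space_normal_set_act:
  fixes g :: "'n rmat"
  assumes g: "g \<in> O1n"
  shows "half_space_normal (set_act g base_half_space) (g *v e_last)
    \<or> half_space_normal (set_act g base_half_space) (- (g *v e_last))"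
proof -
  define a where "a = g *v e_first"
  define b where "b = g *v e_last"
  have a: "lorentz a a = - 1" and b: "lorentz b b = 1"
    using lorentz_O1n[OF g] by (simp_all add: a_def b_def lorentz_e_last[OF card] axis_first_last[OF card])
  have mem: "span {x} \<in> set_act g base_half_space \<longleftrightarrow> lorentz x a * lorentz x b < 0" if "x \<in> future" for x
    using span_mem_half_space[OF g that] by (simp add: a_def b_def)
  have "a $ idx_first \<noteq> 0" using a by (auto simp: lorentz_self) (smt (verit) zero_le_power2)
  then consider "0 < a $ idx_first" | "0 < (- a) $ idx_first" by fastforce
  then show ?thesis
  proof cases
    case 1
    then have "lorentz x a < 0" if "x \<in> future" for x
      using lorentz_timelike_neg[OF that, of a] a by simp
    then have "half_space_normal (set_act g base_half_space) b"
      using b mem by (force simp: half_space_normal_def mult_less_0_iff)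
    then show ?thesis by (simp add: b_def)
  next
    case 2
    then have "0 < lorentz x a" if "x \<in> future" for x
      using lorentz_timelike_neg[OF that, of "- a"] a by simp
    then have "half_space_normal (set_act g base_half_space) (- b)"
      using b mem by (force simp: half_space_normal_def mult_less_0_iff)
    then show ?thesis by (simp add: b_def)
  qed
qed

lemma half_space_normal_exists:
  fixes H :: "'n rvec set set"
  assumes "H \<in> half_spaces"
  obtains v where "half_space_normal H v"
  using assms half_space_normal_set_act by (auto simp: half_spaces_def)

lemma half_space_eq_set_act:
  fixes H :: "'n rvec set set"
  assumes H: "H \<in> half_spaces" "half_space_normal H v"
    and g: "g \<in> O1n" "g *v e_first \<in> future" "g *v e_last = v"
  shows "H = set_act g base_half_space"
proof (rule half_space_eqI)
  show "set_act g base_half_space \<in> half_spaces" using g by (auto simp: half_spaces_def)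
  fix x :: "'n rvec" assume x: "x \<in> future"
  have "lorentz x (g *v e_first) < 0"
    using future_lorentz_le[OF x g(2)] by simp
  then show "span {x} \<in> H \<longleftrightarrow> span {x} \<in> set_act g base_half_space"
    using H(2) x unfolding span_mem_half_space[OF g(1) x] g(3)
    by (auto simp: mult_less_0_iff half_space_normal_def)
qed (rule H(1))

text \<open>
  If \<open>v\<^sup>n \<le> 0\<close>, then \<open>v - e\<^sub>n\<close> is far from the light cone, \<open>\<langle>v - e\<^sub>n, v - e\<^sub>n\<rangle> = 2 - 2 v\<^sup>n \<ge> 2\<close>, and
  the reflection in it carries \<open>e\<^sub>n\<close> to \<open>v\<close> and depends continuously on \<open>v\<close>. If \<open>v\<^sup>n \<ge> 0\<close>, the
  reflection in \<open>v + e\<^sub>n\<close> carries \<open>-e\<^sub>n\<close> to \<open>v\<close>, and reflecting in \<open>e\<^sub>n\<close> beforehand corrects the sign.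
  So two continuous images of compact sets of normals suffice.
\<close>

lemma compact_family_moving_e_last:
  obtains G :: "'n rmat set" where "compact G" "G \<subseteq> O1n"
    "\<And>v. lorentz v v = 1 \<Longrightarrow> norm v \<le> R \<Longrightarrow> \<exists>g\<in>G. g *v e_first \<in> future \<and> g *v e_last = v"
proof -
  define V where "V \<sigma> = {v :: 'n rvec. norm v \<le> R \<and> lorentz v v = 1 \<and> \<sigma> * v $ idx_last \<le> 0}" for \<sigma> :: real
  have "closed (V \<sigma>)" for \<sigma>
    unfolding V_def by (intro closed_Collect_conj closed_Collect_le closed_Collect_eq continuous_intros)
  moreover have "bounded (V \<sigma>)" for \<sigma>
    by (rule boundedI[of _ R]) (simp add: V_def)
  ultimately have compact: "compact (V \<sigma>)" for \<sigma>
    by (simp add: compact_eq_bounded_closed)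
  note last = lorentz_e_last[OF card] axis_first_last[OF card]
  define h\<^sub>1 where "h\<^sub>1 v = reflect (v - e_last)" for v :: "'n rvec"
  define h\<^sub>2 where "h\<^sub>2 v = (\<lambda>x. reflect (v + e_last) (reflect e_last x))" for v :: "'n rvec"
  have pos1: "0 < lorentz (v - e_last) (v - e_last)" if "v \<in> V 1" for v
    using that by (simp add: V_def last)
  have pos2: "0 < lorentz (v + e_last) (v + e_last)" if "v \<in> V (- 1)" for v
    using that by (simp add: V_def last)
  define G where "G = (\<lambda>v. matrix (h\<^sub>1 v)) ` V 1 \<union> (\<lambda>v. matrix (h\<^sub>2 v)) ` V (- 1)"
  have lin1: "linear (h\<^sub>1 v)" and lin2: "linear (h\<^sub>2 v)" for v
    unfolding h\<^sub>1_def h\<^sub>2_def using linear_reflect linear_compose[OF linear_reflect linear_reflect]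
    by (auto simp: comp_def)
  have O1: "matrix (h\<^sub>1 v) \<in> O1n" if "v \<in> V 1" for v
    using pos1[OF that] by (intro matrix_in_O1n lin1) (simp add: h\<^sub>1_def)
  have O2: "matrix (h\<^sub>2 v) \<in> O1n" if "v \<in> V (- 1)" for v
    using pos2[OF that] by (intro matrix_in_O1n lin2) (simp add: h\<^sub>2_def last)
  have "compact G"
    unfolding G_def
  proof (intro compact_Un compact_continuous_image compact continuous_on_matrix)
    show "continuous_on (V 1) (\<lambda>v. h\<^sub>1 v x)" for x
      unfolding h\<^sub>1_def by (intro continuous_on_reflect continuous_intros) (use pos1 in force)
    show "continuous_on (V (- 1)) (\<lambda>v. h\<^sub>2 v x)" for x
      unfolding h\<^sub>2_def by (intro continuous_on_reflect continuous_intros) (use pos2 in force)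
  qed
  moreover have "G \<subseteq> O1n" using O1 O2 by (auto simp: G_def)
  moreover have "\<exists>g\<in>G. g *v e_first \<in> future \<and> g *v e_last = v"
    if v: "lorentz v v = 1" and norm: "norm v \<le> R" for v
  proof (cases "v $ idx_last \<le> 0")
    case True
    then have V: "v \<in> V 1" using norm v by (simp add: V_def)
    have "reflect (v - e_last) v = e_last"
      using pos1[OF V] v by (intro reflect_swap) (simp_all add: last)
    then have "h\<^sub>1 v e_last = v"
      using pos1[OF V] reflect_reflect[of "v - e_last" v] by (simp add: h\<^sub>1_def)
    moreover have "h\<^sub>1 v e_first \<in> future"
      unfolding h\<^sub>1_def by (intro reflect_future pos1 V e_first_future)
    ultimately show ?thesis
      using V by (intro bexI[of _ "matrix (h\<^sub>1 v)"]) (auto simp: G_def matrix_linear_works lin1)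
  next
    case False
    then have V: "v \<in> V (- 1)" using norm v by (simp add: V_def)
    have "reflect (v - (- e_last)) v = - e_last"
      using pos2[OF V] v by (intro reflect_swap) (simp_all add: last)
    then have "reflect (v + e_last) (- e_last) = v"
      using pos2[OF V] reflect_reflect[of "v + e_last" v] by simp
    moreover have "reflect e_last e_last = - (e_last :: 'n rvec)"
      by (simp add: reflect_def last) (simp add: scaleR_2)
    ultimately have "h\<^sub>2 v e_last = v" by (simp add: h\<^sub>2_def)
    moreover have "h\<^sub>2 v e_first \<in> future"
      unfolding h\<^sub>2_def by (intro reflect_future pos2 V e_first_future) (simp add: last)
    ultimately show ?thesis
      using V by (intro bexI[of _ "matrix (h\<^sub>2 v)"]) (auto simp: G_def matrix_linear_works lin2)
  qed
  ultimately show ?thesis using that by blast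
qed

text \<open>
  Testing on the timelike vectors \<open>e\<^sub>0 + t e\<^sub>i\<close> with \<open>|t| < 1\<close> determines every coordinate of \<open>w\<close>, up to the
  length, which the normalization fixes.
\<close>

lemma eq_e_last_if_same_half_space:
  fixes w :: "'n rvec"
  assumes w: "lorentz w w = 1" and same: "\<And>x. x \<in> future \<Longrightarrow> 0 < x $ idx_last \<longleftrightarrow> 0 < lorentz x w"
  shows "w = e_last"
proof -
  note last = lorentz_e_last[OF card] axis_first_last[OF card] first_neq_last[OF card]
  have same': "0 < x $ idx_last \<longleftrightarrow> 0 < lorentz x w" if x: "lorentz x x < 0" "0 < x $ idx_first" for x
    using same[OF normalize_timelike[OF x]] x by (simp add: zero_less_divide_iff)
  have axis: "\<bar>t\<bar> < 1 \<Longrightarrow> 0 < t * axis i 1 $ idx_last \<longleftrightarrow> w $ idx_first < t * w $ i"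
    if i: "i \<noteq> idx_first" for t i
  proof -
    assume t: "\<bar>t\<bar> < 1"
    have "t * t < 1" using t by (simp add: abs_square_less_1 flip: power2_eq_square)
    then show ?thesis
      using same'[of "e_first + t *\<^sub>R axis i 1"] i
      by (simp add: last lorentz_eq_inner[of "axis i 1"] lorentz_eq_inner[of _ "axis i 1"] inner_axis inner_axis')
        (simp add: axis_def)
  qed
  have w_first: "w $ idx_first = 0"
  proof (rule antisym)
    show "0 \<le> w $ idx_first" using axis[of idx_last 0] by (simp add: last)
    show "w $ idx_first \<le> 0"
    proof (rule field_le_epsilon)
      fix e :: real assume e: "0 < e"
      \<comment> \<open>This \<open>t\<close> is small enough for \<open>e\<^sub>0 + t e\<^sub>n\<close> to be timelike and for \<open>t w\<^sup>n \<le> e\<close>.\<close>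
      define t where "t = min (1/2) (e / (1 + \<bar>w $ idx_last\<bar>))"
      have "0 < t" "\<bar>t\<bar> < 1" using e by (auto simp: t_def)
      then have "w $ idx_first < t * w $ idx_last" using axis[of idx_last t] by (simp add: last)
      also have "\<dots> \<le> t * (1 + \<bar>w $ idx_last\<bar>)" using \<open>0 < t\<close> by (intro mult_left_mono) auto
      also have "\<dots> \<le> e"
      proof -
        have "t \<le> e / (1 + \<bar>w $ idx_last\<bar>)" by (simp add: t_def)
        then show ?thesis by (subst (asm) pos_le_divide_eq) auto
      qed
      finally show "w $ idx_first \<le> 0 + e" by simp
    qed
  qed
  have other: "w $ i = 0" if "i \<noteq> idx_first" "i \<noteq> idx_last" for i
    using axis[of i "1/2"] axis[of i "- (1/2)"] that w_first by (simp add: axis_def)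
  have pos: "0 < w $ idx_last" using axis[of idx_last "1/2"] w_first by (simp add: last)
  have w_eq: "w = (w $ idx_last) *\<^sub>R e_last"
  proof (rule vec_eq_iff[THEN iffD2], rule allI)
    fix i show "w $ i = ((w $ idx_last) *\<^sub>R e_last) $ i"
      using w_first other[of i] by (cases "i = idx_first") (auto simp: axis_def)
  qed
  have "lorentz w w = (w $ idx_last)\<^sup>2"
    by (subst (1) w_eq) (simp add: last power2_eq_square)
  then have "w $ idx_last = 1" using w pos by (simp add: power2_eq_1_iff)
  then show ?thesis using w_eq by simp
qed

text \<open>
  An element of \<open>O(1,n)\<close> that preserves \<open>future\<close> carries \<open>e\<^sub>n\<close> to \<open>v\<close> and reduces this to the base
  half-space.
\<close>

lemma half_space_normal_unique:
  fixes v w :: "'n rvec"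
  assumes v: "half_space_normal H v" and w: "half_space_normal H w"
  shows "v = w"
proof -
  have "lorentz v v = 1" using v by (simp add: half_space_normal_def)
  then obtain g where g: "g \<in> O1n" "g *v e_first \<in> future" "g *v e_last = v"
    using compact_family_moving_e_last[of "norm v"] by (metis order_refl subsetD)
  obtain g' where "g ** g' = mat 1" using g(1) by (auto simp: O1n_def invertible_def)
  define w' where "w' = g' *v w"
  have gw': "g *v w' = w"
    using \<open>g ** g' = mat 1\<close> by (simp add: w'_def matrix_vector_mul_assoc)
  have "w' = e_last"
  proof (rule eq_e_last_if_same_half_space)
    show "lorentz w' w' = 1"
      using lorentz_O1n[OF g(1), of w' w'] w by (simp add: gw' half_space_normal_def)
    fix x :: "'n rvec" assume x: "x \<in> future"
    have neg: "lorentz (g *v x) (g *v x) = -1" "lorentz (g *v e_first) (g *v x) < 0"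
      using x by (simp_all add: lorentz_O1n[OF g(1)] future_def)
    then have "g *v x \<in> future"
      using lorentz_timelike_neg[OF g(2), of "g *v x"] by (simp add: future_def)
    then have "0 < lorentz (g *v x) v \<longleftrightarrow> 0 < lorentz (g *v x) w"
      using v w by (auto simp: half_space_normal_def)
    then show "0 < x $ idx_last \<longleftrightarrow> 0 < lorentz x w'"
      by (simp add: lorentz_O1n[OF g(1)] lorentz_e_last[OF card] flip: g(3) gw')
  qed
  then show ?thesis using g(3) gw' by simp
qed

lemma openin_half_spaces_at:
  fixes x :: "'n rvec"
  assumes x: "x \<in> future"
  shows "openin half_space_topology (half_spaces_at (span {x}))"
proof -
  have "open {g :: 'n rmat. lorentz x (g *v e_first) * lorentz x (g *v e_last) < 0}"
    by (intro open_Collect_less continuous_intros continuous_on_matrix_vector)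
  moreover have "{g \<in> O1n. set_act g base_half_space \<in> half_spaces_at (span {x})}
      = O1n \<inter> {g. lorentz x (g *v e_first) * lorentz x (g *v e_last) < 0}"
    using span_mem_half_space[OF _ x] by (auto simp: half_spaces_at_def half_spaces_def)
  ultimately show ?thesis
    unfolding openin_half_space_topology by (auto simp: half_spaces_at_def openin_open_Int)
qed

text \<open>
  These sets are compact, being closed subsets of images of compact sets of group elements. That they
  are closed matters separately: a Radon measure is finite on compact sets, but this bounds the
  measure of subsets only if the compact set is Borel. Closedness holds because \<open>gH\<^sub>0\<close> has
  the unique normal \<open>\<plusminus>g e\<^sub>n\<close>, so that the set is given by the closed condition \<open>|g e\<^sub>n| \<le> R\<close>.
\<close>

lemma bounded_normal_half_spaces:
  fixes R :: real
  defines "K \<equiv> {H :: 'n rvec set set. H \<in> half_spaces \<and> (\<exists>v. half_space_normal H v \<and> norm v \<le> R)}"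
  shows closedin_bounded_normal_half_spaces: "closedin half_space_topology K"
    and compactin_bounded_normal_half_spaces: "compactin half_space_topology K"
proof -
  have K_iff: "set_act g base_half_space \<in> K \<longleftrightarrow> norm (g *v e_last) \<le> R" if g: "g \<in> O1n" for g
  proof -
    obtain v where v: "half_space_normal (set_act g base_half_space) v" "norm v = norm (g *v e_last)"
      using half_space_normal_set_act[OF g] by (metis norm_minus_cancel)
    have "set_act g base_half_space \<in> half_spaces" using g by (auto simp: half_spaces_def)
    then show ?thesis
      using v half_space_normal_unique[OF v(1)] unfolding K_def mem_Collect_eq by metis
  qed
  have "open {g :: 'n rmat. R < norm (g *v e_last)}"
    by (intro open_Collect_less continuous_intros continuous_on_matrix_vector)
  moreover have "{g \<in> O1n. set_act g base_half_space \<in> half_spaces - K}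
      = O1n \<inter> {g. R < norm (g *v e_last)}"
    using K_iff by (force simp: half_spaces_def)
  ultimately have "openin half_space_topology (half_spaces - K)"
    unfolding openin_half_space_topology by (auto simp: openin_open_Int)
  then show closed: "closedin half_space_topology K"
    by (auto simp: closedin_def topspace_half_space_topology K_def)
  obtain G :: "'n rmat set" where G: "compact G" "G \<subseteq> O1n"
    "\<And>v. lorentz v v = 1 \<Longrightarrow> norm v \<le> R \<Longrightarrow> \<exists>g\<in>G. g *v e_first \<in> future \<and> g *v e_last = v"
    using compact_family_moving_e_last[of R] by blast
  have "compactin (top_of_set O1n) G"
    using G(1,2) by (simp add: compactin_subtopology)
  then have "compactin half_space_topology ((\<lambda>g. set_act g base_half_space) ` G)"
    by (rule image_compactin) (rule quotient_imp_continuous_map[OF quotient_map_half_spaces])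
  moreover have "K \<subseteq> (\<lambda>g. set_act g base_half_space) ` G"
  proof
    fix H assume "H \<in> K"
    then obtain v where H: "H \<in> half_spaces" "half_space_normal H v" "norm v \<le> R"
      by (auto simp: K_def)
    then obtain g where "g \<in> G" "g *v e_first \<in> future" "g *v e_last = v"
      using G(3)[of v] by (auto simp: half_space_normal_def)
    then show "H \<in> (\<lambda>g. set_act g base_half_space) ` G"
      using half_space_eq_set_act[OF H(1,2)] G(2) by blast
  qed
  ultimately show "compactin half_space_topology K"
    using closed by (rule closed_compactin)
qed

text \<open>
  The three hypotheses on \<open>F\<close> in \<open>geodesically_additive_eq_distance\<close> hold for the measure of the set
  \<open>S x y\<close> of half-spaces separating \<open>x\<close> and \<open>y\<close>: \<open>S x y\<close> lies in a compact set, \<open>S\<close> is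
  equivariant under reflections, and convexity makes \<open>S x z\<close> the disjoint union of \<open>S x y\<close> and \<open>S y z\<close>
  for \<open>y\<close> between \<open>x\<close> and \<open>z\<close>. Countably many \<open>S x y\<close> cover the whole space, so the constant is positive.
\<close>

lemma invariant_measure_eq_distance:
  fixes M :: "'n rvec set set measure"
  assumes M: "invariant_half_space_measure M"
  obtains c where "0 < c"
    "\<And>x y. x \<in> future \<Longrightarrow> y \<in> future \<Longrightarrow>
      emeasure M (sym_diff (half_spaces_at (span {x})) (half_spaces_at (span {y})))
        = ennreal (c * hyp_dist (span {x}) (span {y}))"
proof -
  have radon: "radon_measure half_space_topology M" and nz: "emeasure M (space M) \<noteq> 0"
    and inv: "\<And>g A. g \<in> O1n \<Longrightarrow> A \<in> sets M \<Longrightarrow> emeasure M (set_act g ` A) = emeasure M A"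
    using M by (auto simp: invariant_half_space_measure_def)
  have space: "space M = half_spaces"
    using radon by (simp add: radon_measure_def topspace_half_space_topology)
  have open_sets: "U \<in> sets M" if "openin half_space_topology U" for U
    using radon that by (auto simp: radon_measure_def)
  define S where "S x y = sym_diff (half_spaces_at (span {x})) (half_spaces_at (span {y}))"
    for x y :: "'n rvec"
  have S_sets [measurable]: "S x y \<in> sets M" if "x \<in> future" "y \<in> future" for x y
    unfolding S_def using that by (intro sets.Un sets.Diff open_sets openin_half_spaces_at)
  have mem_S: "H \<in> S x y \<longleftrightarrow> H \<in> half_spaces \<and> separates v x y"
    if "x \<in> future" "y \<in> future" "half_space_normal H v" for H v x y
    using that unfolding half_space_normal_def by (auto simp: S_def half_spaces_at_def separates_def)
  have fin: "emeasure M (S x y) < \<infinity>" if xy: "x \<in> future" "y \<in> future" for x y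
  proof -
    obtain R where R: "\<And>v. lorentz v v \<le> 1 \<Longrightarrow> separates v x y \<Longrightarrow> norm v \<le> R"
      using separates_bounded[OF card xy] by blast
    define K where "K = {H :: 'n rvec set set. H \<in> half_spaces \<and> (\<exists>v. half_space_normal H v \<and> norm v \<le> R)}"
    have "S x y \<subseteq> K"
    proof
      fix H assume HS: "H \<in> S x y"
      then have H: "H \<in> half_spaces" by (auto simp: S_def half_spaces_at_def)
      obtain v where v: "half_space_normal H v" using half_space_normal_exists[OF H] .
      then have "norm v \<le> R" using mem_S[OF xy v] HS R[of v] by (simp add: half_space_normal_def)
      then show "H \<in> K" using H v by (auto simp: K_def)
    qed
    moreover have "half_spaces - K \<in> sets M"
      using closedin_bounded_normal_half_spaces[of R] unfolding K_def
      by (intro open_sets) (simp add: closedin_def topspace_half_space_topology)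
    then have "K \<in> sets M"
      using sets.compl_sets[of "half_spaces - K" M] by (simp add: space K_def double_diff)
    ultimately have "emeasure M (S x y) \<le> emeasure M K" by (rule emeasure_mono)
    also have "\<dots> < \<infinity>"
      using radon compactin_bounded_normal_half_spaces[of R] by (simp add: radon_measure_def K_def)
    finally show ?thesis .
  qed
  have refl: "emeasure M (S (reflect u x) (reflect u y)) = emeasure M (S x y)"
    if u: "0 < lorentz u u" and xy: "x \<in> future" "y \<in> future" for u x y
  proof -
    define g where "g = matrix (reflect u)"
    have works: "g *v z = reflect u z" for z
      by (simp add: g_def matrix_linear_works linear_reflect)
    have g: "g \<in> O1n"
      unfolding g_def using u by (intro matrix_in_O1n linear_reflect) simp
    have gg: "g ** g = mat 1"
      using u by (simp add: matrix_eq works flip: matrix_vector_mul_assoc)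
    have "set_act g ` S x y = S (reflect u x) (reflect u y)"
      by (simp add: S_def image_Un image_set_diff half_spaces_at_involution[OF g gg] pt_act_span works)
    then show ?thesis using inv[OF g S_sets[OF xy]] by simp
  qed
  have add: "emeasure M (S x z) = emeasure M (S x y) + emeasure M (S y z)"
    if "x \<in> future" "y \<in> future" "z \<in> future" "0 \<le> a" "0 \<le> b" "y = a *\<^sub>R x + b *\<^sub>R z"
    for x y z a b
  proof -
    have "(H \<in> S x z \<longleftrightarrow> H \<in> S x y \<or> H \<in> S y z) \<and> \<not> (H \<in> S x y \<and> H \<in> S y z)" for H
    proof (cases "H \<in> half_spaces")
      case True
      then obtain v where v: "half_space_normal H v" by (rule half_space_normal_exists)
      show ?thesis
        using separates_between[OF card that, of v] that(1-3) True by (simp add: mem_S[OF _ _ v])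
    qed (auto simp: S_def half_spaces_at_def)
    then have "S x z = S x y \<union> S y z" "S x y \<inter> S y z = {}" by blast+
    then show ?thesis using that by (simp add: plus_emeasure)
  qed
  have "\<exists>c\<ge>0. \<forall>x\<in>future. \<forall>y\<in>future.
      emeasure M (S x y) = ennreal (c * hyp_dist (span {x}) (span {y}))"
    by (rule geodesically_additive_eq_distance[OF card, of "\<lambda>x y. emeasure M (S x y)"])
      (fact refl add fin)+
  then obtain c where c: "0 \<le> c" and
    eq: "\<And>x y. x \<in> future \<Longrightarrow> y \<in> future \<Longrightarrow>
      emeasure M (S x y) = ennreal (c * hyp_dist (span {x}) (span {y}))"
    by blast
  have "c \<noteq> 0"
  proof
    assume "c = 0"
    then have null: "S x y \<in> null_sets M" if "x \<in> future" "y \<in> future" for x y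
      using eq[OF that] that by auto
    obtain D :: "'n rvec set" where D: "countable D" "D \<subseteq> future"
      "\<And>v. 0 < lorentz v v \<Longrightarrow> \<exists>x\<in>D. \<exists>y\<in>D. separates v x y"
      using countable_separating_set[OF card] by blast
    have "half_spaces \<subseteq> (\<Union>x\<in>D. \<Union>y\<in>D. S x y)"
    proof
      fix H :: "'n rvec set set" assume H: "H \<in> half_spaces"
      obtain v where v: "half_space_normal H v" using half_space_normal_exists[OF H] .
      then obtain x y where "x \<in> D" "y \<in> D" "separates v x y"
        using D(3)[of v] by (auto simp: half_space_normal_def)
      then show "H \<in> (\<Union>x\<in>D. \<Union>y\<in>D. S x y)"
        using mem_S[OF _ _ v] H D(2) by blast
    qed
    moreover have "(\<Union>x\<in>D. \<Union>y\<in>D. S x y) \<in> null_sets M"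
      using D(1,2) null by (intro null_sets_UN') auto
    ultimately have "space M \<in> null_sets M"
      using null_sets_subset[of _ M "space M"] sets.top[of M] unfolding space by blast
    then show False using nz by auto
  qed
  then show ?thesis using that[of c] c eq by (simp add: S_def)
qed

end

section \<open>Hyperbolic distance as a measure of half-spaces\<close>

theorem corollary2p5:
  fixes n :: nat
  assumes "n \<ge> 1"
    and "CARD('n::{finite,linorder}) = n + 1"
  shows "(\<forall>\<mu> :: ('n rvec) set set measure. invariant_half_space_measure \<mu> \<longrightarrow>
            (\<exists>k::real. k > 0 \<and>
               (\<forall>x\<in>hyp_space. \<forall>y\<in>hyp_space.
                  ennreal (hyp_dist x y) =
                    ennreal k * emeasure \<mu> (sym_diff (half_spaces_at x) (half_spaces_at y)))))
       \<and> kernel_of_negative_type (hyp_space :: ('n rvec) set set) hyp_dist"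
proof (intro conjI allI impI)
  have card: "2 \<le> CARD('n)" using assms by simp
  show "kernel_of_negative_type (hyp_space :: ('n rvec) set set) hyp_dist"
    by (rule kernel_of_negative_type_hyp_dist[OF card])
  fix \<mu> :: "('n rvec) set set measure"
  assume "invariant_half_space_measure \<mu>"
  then obtain c where c: "0 < c" "\<And>x y :: 'n rvec. x \<in> future \<Longrightarrow> y \<in> future \<Longrightarrow>
      emeasure \<mu> (sym_diff (half_spaces_at (span {x})) (half_spaces_at (span {y})))
        = ennreal (c * hyp_dist (span {x}) (span {y}))"
    using invariant_measure_eq_distance[OF card] by blast
  show "\<exists>k::real. k > 0 \<and> (\<forall>x\<in>hyp_space. \<forall>y\<in>hyp_space.
      ennreal (hyp_dist x y) =
        ennreal k * emeasure \<mu> (sym_diff (half_spaces_at x) (half_spaces_at y)))"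
    using c by (intro exI[of _ "1 / c"]) (auto simp: hyp_space_eq simp flip: ennreal_mult')
qed

end
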